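(* Let $\mathrm{X}=(X_n)_{n\ge1}$ be a sequence of random variables in $\mathbb{T}$, each distributed according to Lebesgue measure, and let $\mathrm{r}=(r_n)_{n\ge1}$ be a sequence of reals in $(0,1]$. Let $G$ be a nonempty compact subset of $\mathbb{T}$ and $g$ a gauge function with $\mathcal{H}^g(G)>0$. Then for any gauge functions $h$ and $\varphi$ with $h\prec_\varphi g$: if $\Theta(\mathrm{X},\mathcal{B}(\mathrm{r}))<\infty$ and $\sum_n r_n/\varphi(r_n)=\infty$, then almost surely $\mathcal{H}^h(\mathcal{E}(\mathrm{X},\mathrm{r})\cap G)>0$.
   Context: $\mathbb{T}=\mathbb{R}/\mathbb{Z}$ with quotient distance $d$. $\mathcal{E}(\mathrm{X},\mathrm{r})=\{\xi\in\mathbb{T}: d(\xi,X_n)<r_n\text{ for infinitely many }n\}$. A gauge function is a nondecreasing right-continuous function on $[0,\infty)$ vanishing at zero and only at zero; $\mathcal{H}^g$ is the Hausdorff $g$-measure. For a sequence $\mathrm{B}=(B_n)$ of Borel subsets of $\mathbb{T}$ of positive Lebesgue measure, $\theta(\mathrm{X},\mathrm{B})=\sup_{n\ge1}\frac{\mathbb{P}(X_1\in B_1,\dots,X_n\in B_n)}{\prod_{i=1}^n\mathbb{P}(X_i\in B_i)}$ and $\Theta(\mathrm{X},\mathcal{B})=\sup_{\mathrm{B}\in\mathcal{B}}\theta(\mathrm{X},\mathrm{B})$. With $q_n=\lceil1/r_n\rceil$ and $I_{n,k}$ the image of $[k/q_n,(k+1)/q_n)$ in $\mathbb{T}$, $\mathcal{B}(\mathrm{r})$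 is the collection of all sequences $(I_{n,k_n})_{n\ge1}$ with $0\le k_n<q_n$. For gauge functions $g,h,\varphi$, one writes $h\prec_\varphi g$ if $g/h$ monotonically tends to zero at the origin and $\sum_{j=1}^\infty\frac{g(2^{-j})}{h(2^{-j})}\left(\frac{1}{\varphi(2^{-j})}-\frac{1}{\varphi(2^{-(j-1)})}\right)<\infty$. *)

theory Defs
  imports "HOL-Probability.Probability"
begin

text \<open>The circle T = R/Z is modelled by the carrier set {0..<1} of real numbers
  (one representative per class), with the quotient distance.\<close>

definition torus :: "real set" where
  "torus = {0..<1}"

definition tdist :: "real \<Rightarrow> real \<Rightarrow> real" where
  "tdist x y = min (frac (x - y)) (1 - frac (x - y))"

definition ttop :: "real topology" where
  "ttop = Metric_space.mtopology torus tdist"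

definition tdiam :: "real set \<Rightarrow> real" where
  "tdiam U = (if U = {} then 0 else (SUP x\<in>U. SUP y\<in>U. tdist x y))"

definition gauge_fun :: "(real \<Rightarrow> real) \<Rightarrow> bool" where
  "gauge_fun g \<longleftrightarrow> mono_on {0..} g \<and> (\<forall>x\<ge>0. continuous (at_right x) g)
      \<and> (\<forall>x\<ge>0. g x = 0 \<longleftrightarrow> x = 0)"

definition hausdorff_pre :: "(real \<Rightarrow> real) \<Rightarrow> real \<Rightarrow> real set \<Rightarrow> ennreal" where
  "hausdorff_pre g \<delta> F = (INF U \<in> {U :: nat \<Rightarrow> real set.
        (\<forall>i. U i \<subseteq> torus \<and> tdiam (U i) \<le> \<delta>) \<and> F \<subseteq> (\<Union>i. U i)}.
        (\<Sum>i. ennreal (g (tdiam (U i)))))"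

definition hausdorff_measure :: "(real \<Rightarrow> real) \<Rightarrow> real set \<Rightarrow> ennreal" where
  "hausdorff_measure g F = (SUP \<delta>\<in>{0<..}. hausdorff_pre g \<delta> F)"

definition Eset :: "(nat \<Rightarrow> real) \<Rightarrow> (nat \<Rightarrow> real) \<Rightarrow> real set" where
  "Eset x r = {\<xi> \<in> torus. \<exists>\<^sub>\<infinity>n. 1 \<le> n \<and> tdist \<xi> (x n) < r n}"

definition theta :: "'a measure \<Rightarrow> (nat \<Rightarrow> 'a \<Rightarrow> real) \<Rightarrow> (nat \<Rightarrow> real set) \<Rightarrow> ereal" where
  "theta M X B = (SUP n\<in>{1..}. ereal (measure M {\<omega> \<in> space M. \<forall>i\<in>{1..n}. X i \<omega> \<in> B i}
        / (\<Prod>i=1..n. measure M {\<omega> \<in> space M. X i \<omega> \<in> B i})))"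

definition Theta :: "'a measure \<Rightarrow> (nat \<Rightarrow> 'a \<Rightarrow> real) \<Rightarrow> (nat \<Rightarrow> real set) set \<Rightarrow> ereal" where
  "Theta M X \<B> = (SUP B\<in>\<B>. theta M X B)"

definition qn :: "(nat \<Rightarrow> real) \<Rightarrow> nat \<Rightarrow> nat" where
  "qn r n = nat \<lceil>1 / r n\<rceil>"

definition Ikn :: "(nat \<Rightarrow> real) \<Rightarrow> nat \<Rightarrow> nat \<Rightarrow> real set" where
  "Ikn r n k = {real k / real (qn r n) ..< real (k + 1) / real (qn r n)}"

text \<open>The collection B(r) of sequences (I_{n,k_n})_{n>=1}; entry 0 is irrelevant.\<close>
definition Bcoll :: "(nat \<Rightarrow> real) \<Rightarrow> (nat \<Rightarrow> real set) set" where
  "Bcoll r = {B. \<exists>k :: nat \<Rightarrow> nat. \<forall>n\<ge>1. k n < qn r n \<and> B n = Ikn r n (k n)}"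

definition gauge_prec :: "(real \<Rightarrow> real) \<Rightarrow> (real \<Rightarrow> real) \<Rightarrow> (real \<Rightarrow> real) \<Rightarrow> bool" where
  "gauge_prec h \<phi> g \<longleftrightarrow>
     (\<exists>\<epsilon>>0. mono_on {0<..\<epsilon>} (\<lambda>x. g x / h x)) \<and>
     ((\<lambda>x. g x / h x) \<longlongrightarrow> 0) (at_right 0) \<and>
     summable (\<lambda>j. g (2 powi (- int (Suc j))) / h (2 powi (- int (Suc j))) *
        (1 / \<phi> (2 powi (- int (Suc j))) - 1 / \<phi> (2 powi (- int j))))"

end

theory Submission
  imports Defs
begin

text \<open>The hypothesis on \<open>Theta\<close> says that the indices of the cells \<open>I_{n,k}\<close> containing the \<open>X_n\<close> have a
  law with bounded density with respect to independent uniform indices, so it suffices to bound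
  probabilities of exceptional events in the independent case. There, start from a Frostman measure
  \<open>m\<close> on \<open>G\<close> and multiply it by random densities with mean one, the \<open>i\<close>-th being a weighted sum
  of normalised indicators of the cells with \<open>n\<close> in a block of consecutive indices, with weights
  proportional to \<open>r_n / \<phi> (r_n)\<close>. Since \<open>h \<prec>\<^sub>\<phi> g\<close> forces \<open>g \<le> K h \<phi>\<close> near zero and the sum of the weights diverges, a long block
  changes the total mass by little on average, and so it does with the integral against the measure
  itself of the maximal function \<open>sup_j m(J_j(x)) / h(2^-j)\<close> over dyadic intervals \<open>J_j(x)\<close>. Hence with
  probability close to one every finite stage carries enough mass obeying the bound by \<open>h\<close> to make
  all dyadic covers expensive. The stages are nested compact sets, so their intersection, which lies in
  \<open>E \<inter> G\<close>, has positive content. All measures involved are finite sums of point masses, of a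
  dyadic resolution adapted to the cover at hand, so no limit measure is needed.\<close>

section \<open>Averages over independent uniform indices\<close>

text \<open>All smallness has one source: at scale \<open>level n\<close> a cell has mass of order
  \<psi> h, its coefficient is 1 / (\<open>block_weight\<close> \<phi>), and \<psi> \<le> K \<phi>.
  Every variance therefore carries a factor K / \<open>block_weight\<close>. The constant in the
  mass bound grows from \<open>D\<close> to \<open>D'\<close> with each block, but \<open>D'\<close>
  depends on the block and not on the random indices. So all blocks, and the price below which a
  cover counts as cheap, are fixed in advance, uniformly in the point masses and their resolution.
  Three obstacles shape the estimates. The maximal function is integrated against the measure it is
  built from, so the new density occurs twice. The bounds must not depend on the depth L although
  all scales up to L contribute; this is why only scales at which h has halved are kept, where 1 / h
  sums geometrically. Finally, at scales finer than a cell nothing averages out, and there the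
  smallness comes from \<psi> tending to zero instead.\<close>

locale finite_cells =
  fixes q :: "nat \<Rightarrow> nat"
  assumes q_pos: "0 < q n"
begin

definition avg_at :: "nat \<Rightarrow> ((nat \<Rightarrow> nat) \<Rightarrow> real) \<Rightarrow> (nat \<Rightarrow> nat) \<Rightarrow> real" where
  "avg_at n F w = (\<Sum>c<q n. F (w(n := c))) / real (q n)"

text \<open>Iterated average over the coordinates N, ..., N + k - 1, the others being kept from
  \<open>w\<close>. Conditioning on earlier indices thus amounts to evaluating at a fixed
  \<open>w\<close>.\<close>

primrec Avg :: "nat \<Rightarrow> nat \<Rightarrow> ((nat \<Rightarrow> nat) \<Rightarrow> real) \<Rightarrow> (nat \<Rightarrow> nat) \<Rightarrow> real" where
  "Avg N 0 F = F"
| "Avg N (Suc k) F = Avg N k (avg_at (N + k) F)"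

definition indep_of :: "nat \<Rightarrow> ((nat \<Rightarrow> nat) \<Rightarrow> 'b) \<Rightarrow> bool" where
  "indep_of n F \<longleftrightarrow> (\<forall>w c. F (w(n := c)) = F w)"

lemma avg_at_indep: "indep_of n F \<Longrightarrow> avg_at n F = F"
  using q_pos[of n] by (auto simp: avg_at_def indep_of_def fun_eq_iff)

lemma Avg_add_blocks: "Avg N (k + l) F = Avg N k (Avg (N + k) l F)"
  by (induction l arbitrary: F) (simp_all add: add.assoc)

text \<open>Averaging over coordinates from N on leaves those below N untouched, so the comparison
  may assume that they still agree with \<open>w\<close>. This freezes the past when a block is
  added.\<close>

lemma Avg_mono_agree:
  assumes "\<And>w'. (\<And>i. i < N \<Longrightarrow> w' i = w i) \<Longrightarrow> F w' \<le> G w'"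
  shows "Avg N k F w \<le> Avg N k G w"
  using assms
proof (induction k arbitrary: F G)
  case 0
  then show ?case by simp
next
  case (Suc k)
  show ?case unfolding Avg.simps
  proof (rule Suc.IH)
    fix w' assume "\<And>i. i < N \<Longrightarrow> w' i = w i"
    then show "avg_at (N + k) F w' \<le> avg_at (N + k) G w'"
      unfolding avg_at_def by (intro divide_right_mono sum_mono Suc.prems) auto
  qed
qed

lemma Avg_mono: "(\<And>w. F w \<le> G w) \<Longrightarrow> Avg N k F w \<le> Avg N k G w"
  by (rule Avg_mono_agree)

lemma Avg_plus: "Avg N k (\<lambda>w. F w + G w) w = Avg N k F w + Avg N k G w"
proof (induction k arbitrary: F G)
  case (Suc k)
  have "avg_at (N + k) (\<lambda>w. F w + G w) = (\<lambda>w. avg_at (N + k) F w + avg_at (N + k) G w)"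
    by (auto simp: avg_at_def sum.distrib add_divide_distrib)
  then show ?case by (simp add: Suc.IH)
qed simp

lemma Avg_cmult: "Avg N k (\<lambda>w. a * F w) w = a * Avg N k F w"
proof (induction k arbitrary: F)
  case (Suc k)
  have "avg_at (N + k) (\<lambda>w. a * F w) = (\<lambda>w. a * avg_at (N + k) F w)"
    by (auto simp: avg_at_def sum_distrib_left)
  then show ?case by (simp add: Suc.IH)
qed simp

lemma Avg_const [simp]: "Avg N k (\<lambda>w. a) w = a"
proof (induction k)
  case (Suc k)
  have "avg_at (N + k) (\<lambda>w. a) = (\<lambda>w. a)"
    by (rule avg_at_indep) (simp add: indep_of_def)
  then show ?case by (simp add: Suc.IH)
qed simp

lemma Avg_sum: "finite A \<Longrightarrow> Avg N k (\<lambda>w. \<Sum>i\<in>A. F i w) w = (\<Sum>i\<in>A. Avg N k (F i) w)"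
  by (induction A rule: finite_induct) (simp_all add: Avg_plus)

lemma Avg_factor:
  assumes "n \<in> {N..<N + k}" "indep_of n F"
  shows "Avg N k (\<lambda>w. u (w n) * F w) w = (\<Sum>c<q n. u c) / real (q n) * Avg N k F w"
  using assms
proof (induction k arbitrary: F)
  case (Suc k)
  show ?case
  proof (cases "n = N + k")
    case True
    have "avg_at n (\<lambda>w. u (w n) * F w) = (\<lambda>w. (\<Sum>c<q n. u c) / real (q n) * F w)"
      using Suc.prems(2) by (auto simp: avg_at_def indep_of_def sum_distrib_right)
    then show ?thesis
      using True avg_at_indep[OF Suc.prems(2)] Avg_cmult[of N k "(\<Sum>c<q n. u c) / real (q n)" F w]
      by simp
  next
    case False
    have "avg_at (N + k) (\<lambda>w. u (w n) * F w) = (\<lambda>w. u (w n) * avg_at (N + k) F w)"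
      using False by (auto simp: avg_at_def sum_distrib_left)
    moreover have "indep_of n (avg_at (N + k) F)"
      using False Suc.prems(2) by (auto simp: avg_at_def indep_of_def fun_upd_twist[OF False])
    ultimately show ?thesis using Suc False by simp
  qed
qed simp

lemma Avg_single:
  assumes "n \<in> {N..<N + k}"
  shows "Avg N k (\<lambda>w. u (w n)) w = (\<Sum>c<q n. u c) / real (q n)"
  using Avg_factor[OF assms, of "\<lambda>_. 1" u w] by (simp add: indep_of_def)

text \<open>Additivity of the variance for independent centred summands: the cross terms vanish on
  averaging the last coordinate.\<close>

lemma Avg_square_sum:
  assumes "\<And>n. (\<Sum>c<q n. Z n c) = 0"
  shows "Avg N k (\<lambda>w. (\<Sum>n\<in>{N..<N + k}. Z n (w n))\<^sup>2) w
     = (\<Sum>n\<in>{N..<N + k}. (\<Sum>c<q n. (Z n c)\<^sup>2) / real (q n))"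
proof (induction k)
  case (Suc k)
  let ?R = "\<lambda>w. \<Sum>n\<in>{N..<N + k}. Z n (w n)"
  have eq: "avg_at (N + k) (\<lambda>w. (Z (N + k) (w (N + k)) + ?R w)\<^sup>2) w
      = (?R w)\<^sup>2 + (\<Sum>c<q (N + k). (Z (N + k) c)\<^sup>2) / real (q (N + k))" for w
  proof -
    have R: "?R (w(N + k := c)) = ?R w" for c
      by (rule sum.cong) auto
    have "(\<Sum>c<q (N + k). (Z (N + k) c + x)\<^sup>2)
        = real (q (N + k)) * x\<^sup>2 + 2 * x * (\<Sum>c<q (N + k). Z (N + k) c)
          + (\<Sum>c<q (N + k). (Z (N + k) c)\<^sup>2)" for x
      by (simp add: power2_sum sum.distrib sum_distrib_left mult_ac)
    then show ?thesis
      using assms[of "N + k"] q_pos[of "N + k"]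
      unfolding avg_at_def R by (simp add: add_divide_distrib)
  qed
  show ?case by (simp add: atLeastLessThanSuc eq[abs_def] Avg_plus Suc.IH add.commute)
qed simp

text \<open>The bridge to probabilities: an averaged indicator counts index tuples, each of which
  corresponds to a cylinder event.\<close>

lemma Avg_eq_sum_PiE:
  assumes "\<And>w w'. (\<And>i. i < N \<Longrightarrow> w i = w' i) \<Longrightarrow> F w = F w'"
  shows "Avg 0 N F w = (\<Sum>\<kappa>\<in>PiE {..<N} (\<lambda>n. {..<q n}). F \<kappa>) / (\<Prod>n<N. real (q n))"
  using assms
proof (induction N arbitrary: F)
  case 0
  then show ?case by simp
next
  case (Suc N)
  have "Avg 0 (Suc N) F w = Avg 0 N (avg_at N F) w" by simp
  also have "\<dots> = (\<Sum>\<kappa>\<in>PiE {..<N} (\<lambda>n. {..<q n}). avg_at N F \<kappa>) / (\<Prod>n<N. real (q n))"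
    by (rule Suc.IH) (auto simp: avg_at_def intro!: Suc.prems sum.cong arg_cong2[where f="(/)"])
  also have "(\<Sum>\<kappa>\<in>PiE {..<N} (\<lambda>n. {..<q n}). avg_at N F \<kappa>)
     = (\<Sum>\<kappa>\<in>PiE {..<N} (\<lambda>n. {..<q n}). \<Sum>c<q N. F (\<kappa>(N := c))) / real (q N)"
    by (simp add: avg_at_def sum_divide_distrib)
  also have "(\<Sum>\<kappa>\<in>PiE {..<N} (\<lambda>n. {..<q n}). \<Sum>c<q N. F (\<kappa>(N := c)))
     = (\<Sum>(c, \<kappa>)\<in>{..<q N} \<times> PiE {..<N} (\<lambda>n. {..<q n}). F (\<kappa>(N := c)))"
    by (subst sum.swap) (simp add: sum.cartesian_product)
  also have "\<dots> = (\<Sum>\<kappa>\<in>PiE (insert N {..<N}) (\<lambda>n. {..<q n}). F \<kappa>)"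
    unfolding PiE_insert_eq
    by (subst sum.reindex) (auto intro!: inj_combinator sum.cong)
  finally show ?case by (simp add: lessThan_Suc mult.commute)
qed

end

section \<open>Dyadic intervals and cells\<close>

definition dyad :: "nat \<Rightarrow> real \<Rightarrow> int" where
  "dyad j x = \<lfloor>2 ^ j * x\<rfloor>"

lemma dyad_div:
  assumes "i \<le> j"
  shows "dyad i x = dyad j x div 2 ^ (j - i)"
proof -
  have "(2::real) ^ j * x / 2 ^ (j - i) = 2 ^ i * x"
    using assms by (simp add: power_diff)
  then have "\<lfloor>2 ^ i * x\<rfloor> = \<lfloor>2 ^ j * x / real_of_int (2 ^ (j - i))\<rfloor>" by simp
  also have "\<dots> = \<lfloor>2 ^ j * x\<rfloor> div 2 ^ (j - i)"
    by (rule floor_divide_real_eq_div) simp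
  finally show ?thesis by (simp add: dyad_def)
qed

lemma dyad_coarser: "i \<le> j \<Longrightarrow> dyad j x = dyad j y \<Longrightarrow> dyad i x = dyad i y"
  by (simp add: dyad_div)

lemma abs_diff_scale: "0 \<le> c \<Longrightarrow> \<bar>c * x - c * y\<bar> = \<bar>x - y\<bar> * c" for c x y :: real
  by (metis abs_mult abs_of_nonneg mult.commute right_diff_distrib)

lemma dyad_dist:
  assumes "dyad j x = dyad j y"
  shows "\<bar>x - y\<bar> * 2 ^ j < 1"
proof -
  have "\<bar>2 ^ j * x - 2 ^ j * y\<bar> < 1"
    using assms unfolding dyad_def by linarith
  then show ?thesis by (simp add: abs_diff_scale)
qed

lemma dyad_0: "x \<in> {0..<1} \<Longrightarrow> dyad 0 x = 0"
  by (auto simp: dyad_def floor_eq_iff)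

definition mass :: "real set \<Rightarrow> (real \<Rightarrow> real) \<Rightarrow> nat \<Rightarrow> int \<Rightarrow> real" where
  "mass P m j d = (\<Sum>y\<in>P. m y * of_bool (dyad j y = d))"

lemma mass_nonneg: "(\<And>x. x \<in> P \<Longrightarrow> 0 \<le> m x) \<Longrightarrow> 0 \<le> mass P m j d"
  unfolding mass_def by (intro sum_nonneg) auto

lemma mass_mono: "(\<And>x. x \<in> P \<Longrightarrow> m x \<le> m' x) \<Longrightarrow> mass P m j d \<le> mass P m' j d"
  unfolding mass_def by (intro sum_mono mult_right_mono) auto

lemma mass_le_total: "(\<And>x. x \<in> P \<Longrightarrow> 0 \<le> m x) \<Longrightarrow> mass P m j d \<le> sum m P"
  unfolding mass_def by (intro sum_mono) auto

text \<open>Gauges appear as sequences of their values at 2^-j. The sequence \<psi> is a decreasing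
  majorant of g / h, so that \<psi> h takes the place of g, and 2^-(level n) is comparable to the
  cell length 1 / q n.\<close>

locale weighted_blocks = finite_cells +
  fixes level :: "nat \<Rightarrow> nat" and h \<psi> \<phi> :: "nat \<Rightarrow> real" and K :: real
  assumes level_le: "real (q n) \<le> 2 ^ level n"
    and level_ge: "2 ^ level n \<le> 2 * real (q n)"
    and h_pos: "0 < h j" and h_antimono: "i \<le> j \<Longrightarrow> h j \<le> h i"
    and \<psi>_pos: "0 < \<psi> j" and \<psi>_antimono: "i \<le> j \<Longrightarrow> \<psi> j \<le> \<psi> i"
    and \<psi>_lim: "\<psi> \<longlonglongrightarrow> 0"
    and \<phi>_pos: "0 < \<phi> j"
    and \<psi>_le: "\<psi> j \<le> K * \<phi> j"
    and diverges: "\<not> summable (\<lambda>n. 1 / (real (q n) * \<phi> (level n)))"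
begin

lemma K_pos: "0 < K"
  using \<psi>_le[of 0] \<psi>_pos[of 0] \<phi>_pos[of 0] by (smt (verit) mult_nonpos_nonneg)

definition cell :: "nat \<Rightarrow> real \<Rightarrow> nat" where
  "cell n x = nat \<lfloor>real (q n) * x\<rfloor>"

lemma cell_less: "x \<in> {0..<1} \<Longrightarrow> cell n x < q n"
  using q_pos[of n] by (auto simp: cell_def nat_less_iff floor_less_iff)

lemma sum_cell: "x \<in> {0..<1} \<Longrightarrow> (\<Sum>c<q n. of_bool (cell n x = c) :: real) = 1"
  using cell_less[of x n] by (simp add: of_bool_def)

lemma cell_near_dyad:
  assumes "x \<in> {0..<1}" "y \<in> {0..<1}" "cell n x = cell n y"
  shows "\<bar>dyad (level n) x - dyad (level n) y\<bar> \<le> 2"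
proof -
  have "\<lfloor>real (q n) * x\<rfloor> = \<lfloor>real (q n) * y\<rfloor>"
    using assms by (simp add: cell_def eq_nat_nat_iff)
  then have "\<bar>real (q n) * x - real (q n) * y\<bar> < 1" by linarith
  then have "\<bar>x - y\<bar> * real (q n) < 1" by (simp add: abs_diff_scale)
  then have "\<bar>x - y\<bar> * 2 ^ level n < 2"
    using mult_left_mono[OF level_ge[of n], of "\<bar>x - y\<bar>"] by linarith
  then have "\<bar>2 ^ level n * x - 2 ^ level n * y\<bar> < 2"
    by (simp add: abs_diff_scale)
  then show ?thesis unfolding dyad_def by linarith
qed

lemma dyad_near_cell:
  assumes "x \<in> {0..<1}" "y \<in> {0..<1}" "level n \<le> j" "dyad j x = dyad j y"
  shows "\<bar>int (cell n x) - int (cell n y)\<bar> \<le> 1"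
proof -
  have "\<bar>x - y\<bar> * 2 ^ level n < 1"
    using dyad_dist[OF dyad_coarser[OF assms(3,4)]] .
  then have "\<bar>x - y\<bar> * real (q n) < 1"
    using mult_left_mono[OF level_le[of n], of "\<bar>x - y\<bar>"] by linarith
  then have "\<bar>real (q n) * x - real (q n) * y\<bar> < 1"
    by (simp add: abs_diff_scale)
  then have "\<bar>\<lfloor>real (q n) * x\<rfloor> - \<lfloor>real (q n) * y\<rfloor>\<bar> \<le> 1" by linarith
  then show ?thesis using assms by (simp add: cell_def)
qed

text \<open>A Frostman condition at resolution \<open>L\<close>; \<open>D\<close> records what the
  densities applied so far have cost.\<close>

definition mass_bounded :: "real set \<Rightarrow> nat \<Rightarrow> (real \<Rightarrow> real) \<Rightarrow> real \<Rightarrow> bool" where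
  "mass_bounded P L m D \<longleftrightarrow> (\<forall>x\<in>P. 0 \<le> m x) \<and> (\<forall>j\<le>L. \<forall>d. mass P m j d \<le> D * (\<psi> j * h j))"

text \<open>The scales at which \<open>h\<close> has dropped by a factor of at least two since the previous
  such scale; a bound by \<open>h\<close> at these scales gives one at all scales.\<close>

fun sparse :: "nat \<Rightarrow> bool" where
  "sparse j \<longleftrightarrow> (\<forall>i<j. sparse i \<longrightarrow> 2 * h j \<le> h i)"

declare sparse.simps [simp del]

lemma sparse_0: "sparse 0" by (subst sparse.simps) simp

lemma sparse_below: "\<exists>s\<le>j. sparse s \<and> h s \<le> 2 * h j"
proof (cases "sparse j")
  case True
  then show ?thesis using h_pos[of j] by (intro exI[of _ j]) auto
next
  case False
  then obtain i where "i < j" "sparse i" "h i < 2 * h j"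
    by (subst (asm) sparse.simps) auto
  then show ?thesis by (intro exI[of _ i]) auto
qed

text \<open>Along sparse scales 1 / h at least doubles, so the sum behaves like a geometric series
  dominated by its last term.\<close>

lemma sum_sparse: "(\<Sum>j | sparse j \<and> j \<le> i. 1 / h j) \<le> 2 / h i"
proof (induction i rule: less_induct)
  case (less i)
  have fin: "finite {j. sparse j \<and> j \<le> n}" "finite {j. sparse j \<and> j < n}" for n by auto
  show ?case
  proof (cases "sparse i")
    case True
    have "(\<Sum>j | sparse j \<and> j < i. 1 / h j) \<le> 1 / h i"
    proof (cases "i = 0")
      case True
      then show ?thesis using h_pos[of 0] by simp
    next
      case False
      define p where "p = Max {j. sparse j \<and> j < i}"
      have "{j. sparse j \<and> j < i} \<noteq> {}" using sparse_0 False by auto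
      from Max_in[OF fin(2) this] have p: "sparse p" "p < i" by (auto simp: p_def)
      have "j \<le> p" if "sparse j" "j < i" for j
        using Max_ge[OF fin(2)[of i], of j] that by (auto simp: p_def)
      then have "{j. sparse j \<and> j < i} = {j. sparse j \<and> j \<le> p}"
        using p by (auto intro: order.strict_trans1)
      then have "(\<Sum>j | sparse j \<and> j < i. 1 / h j) \<le> 2 / h p" using less p by simp
      also have "2 * h i \<le> h p" using True p by (subst (asm) sparse.simps) auto
      then have "2 / h p \<le> 1 / h i" using h_pos[of i] h_pos[of p] by (simp add: field_simps)
      finally show ?thesis .
    qed
    moreover have "{j. sparse j \<and> j \<le> i} = insert i {j. sparse j \<and> j < i}" using True by auto
    ultimately show ?thesis using fin by simp
  next
    case False
    then have i: "i \<noteq> 0" using sparse_0 by metis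
    then have "{j. sparse j \<and> j \<le> i} = {j. sparse j \<and> j \<le> i - 1}"
      using False by (auto simp: le_less)
    then have "(\<Sum>j | sparse j \<and> j \<le> i. 1 / h j) \<le> 2 / h (i - 1)" using less[of "i - 1"] i by simp
    also have "\<dots> \<le> 2 / h i"
      using h_antimono[of "i - 1" i] h_pos[of i] h_pos[of "i-1"] by (simp add: frac_le)
    finally show ?thesis .
  qed
qed

section \<open>The maximal function and its integral\<close>

definition maxfun :: "real set \<Rightarrow> nat \<Rightarrow> (real \<Rightarrow> real) \<Rightarrow> real \<Rightarrow> real" where
  "maxfun P L m x = Max ((\<lambda>j. mass P m j (dyad j x) / h j) ` {j. sparse j \<and> j \<le> L})"

lemma scales_finite: "finite {j. sparse j \<and> j \<le> L}" and scales_nonempty: "{j. sparse j \<and> j \<le> L} \<noteq> {}"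
  using sparse_0 by auto

lemma maxfun_ge: "sparse j \<Longrightarrow> j \<le> L \<Longrightarrow> mass P m j (dyad j x) / h j \<le> maxfun P L m x"
  unfolding maxfun_def using scales_finite by (intro Max_ge) auto

lemma maxfun_le:
  "(\<And>j. sparse j \<Longrightarrow> j \<le> L \<Longrightarrow> mass P m j (dyad j x) / h j \<le> B) \<Longrightarrow> maxfun P L m x \<le> B"
  unfolding maxfun_def using scales_finite scales_nonempty by (intro Max.boundedI) auto

lemma maxfun_nonneg: "(\<And>x. x \<in> P \<Longrightarrow> 0 \<le> m x) \<Longrightarrow> 0 \<le> maxfun P L m x"
  using maxfun_ge[OF sparse_0, of L P m x] mass_nonneg[of P m 0 "dyad 0 x"] h_pos[of 0]
  by (smt (verit) divide_nonneg_pos le0)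

text \<open>An energy of the point masses: by Chebyshev's inequality for \<open>m\<close> itself, a
  bound on it yields a large part of the mass on which the maximal function is small.\<close>

definition potential :: "real set \<Rightarrow> nat \<Rightarrow> (real \<Rightarrow> real) \<Rightarrow> real" where
  "potential P L m = (\<Sum>x\<in>P. m x * maxfun P L m x)"

lemma mass_bounded_total:
  assumes "mass_bounded P L m D" "P \<subseteq> {0..<1}"
  shows "(\<Sum>x\<in>P. m x) \<le> D * (\<psi> 0 * h 0)"
proof -
  have "(\<Sum>x\<in>P. m x) = mass P m 0 0"
    unfolding mass_def using assms(2) by (intro sum.cong) (auto simp: dyad_0)
  then show ?thesis using assms(1) by (simp add: mass_bounded_def)
qed

text \<open>By \<open>cell_near_dyad\<close> the points of a cell have dyadic indices within two of
  that of any fixed one among them, so five intervals of that level suffice.\<close>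

lemma cell_mass_le:
  assumes "mass_bounded P L m D" "finite P" "P \<subseteq> {0..<1}" "level n \<le> L" "0 \<le> D"
  shows "(\<Sum>y\<in>P. m y * of_bool (cell n y = c)) \<le> 5 * D * (\<psi> (level n) * h (level n))"
proof (cases "\<exists>x\<in>P. cell n x = c")
  case True
  then obtain x where x: "x \<in> P" "cell n x = c" by auto
  let ?d = "dyad (level n) x"
  have "(\<Sum>y\<in>P. m y * of_bool (cell n y = c))
      \<le> (\<Sum>y\<in>P. \<Sum>d\<in>{?d - 2..?d + 2}. m y * of_bool (dyad (level n) y = d))"
  proof (rule sum_mono)
    fix y assume y: "y \<in> P"
    have m: "0 \<le> m y" using assms(1) y by (simp add: mass_bounded_def)
    show "m y * of_bool (cell n y = c) \<le> (\<Sum>d\<in>{?d - 2..?d + 2}. m y * of_bool (dyad (level n) y = d))"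
    proof (cases "cell n y = c")
      case True
      then have "\<bar>dyad (level n) y - ?d\<bar> \<le> 2" using cell_near_dyad[of y x n] x y assms(3) by (auto simp: subset_iff)
      then have "dyad (level n) y \<in> {?d - 2..?d + 2}" by auto
      then show ?thesis using True by (simp add: of_bool_def if_distrib cong: if_cong)
    next
      case False
      then show ?thesis using m by (auto intro!: sum_nonneg)
    qed
  qed
  also have "\<dots> = (\<Sum>d\<in>{?d - 2..?d + 2}. mass P m (level n) d)"
    unfolding mass_def by (rule sum.swap)
  also have "\<dots> \<le> (\<Sum>d\<in>{?d - 2..?d + 2}. D * (\<psi> (level n) * h (level n)))"
    using assms(1,4) by (intro sum_mono) (simp add: mass_bounded_def)
  finally show ?thesis by simp
next
  case False
  then have "(\<Sum>y\<in>P. m y * of_bool (cell n y = c)) = 0" by (intro sum.neutral) auto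
  then show ?thesis using assms(5) \<psi>_pos[of "level n"] h_pos[of "level n"] by simp
qed

end

section \<open>Fluctuations of a random density\<close>

text \<open>A substitute for the Cauchy-Schwarz inequality that is linear in the square and hence
  passes through averages.\<close>

lemma abs_le_square:
  fixes b \<eta> :: real
  assumes "0 < \<eta>"
  shows "\<bar>b\<bar> \<le> \<eta> + 1 / \<eta> * b\<^sup>2"
proof -
  have "0 \<le> (\<bar>b\<bar> - \<eta>)\<^sup>2" by simp
  then have "2 * \<bar>b\<bar> * \<eta> \<le> \<eta>\<^sup>2 + b\<^sup>2" by (simp add: power2_diff)
  moreover have "0 \<le> \<bar>b\<bar> * \<eta>" using assms by simp
  ultimately have "\<bar>b\<bar> * \<eta> \<le> \<eta>\<^sup>2 + b\<^sup>2" by linarith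
  then show ?thesis using assms by (simp add: field_simps power2_eq_square)
qed

context weighted_blocks begin

definition block_weight :: "nat \<Rightarrow> nat \<Rightarrow> real" where
  "block_weight N k = (\<Sum>n\<in>{N..<N + k}. 1 / (real (q n) * \<phi> (level n)))"

text \<open>The normalised weights \<open>1 / (q n * \<phi> (level n))\<close>, divided by the probability \<open>1 / q n\<close> of a cell,
  so that the random density below has mean one.\<close>

definition block_coeff :: "nat \<Rightarrow> nat \<Rightarrow> nat \<Rightarrow> real" where
  "block_coeff N k n = 1 / (block_weight N k * \<phi> (level n))"

definition dens :: "nat \<Rightarrow> nat \<Rightarrow> (nat \<Rightarrow> nat) \<Rightarrow> real \<Rightarrow> real" where
  "dens N k w x = (\<Sum>n\<in>{N..<N + k}. block_coeff N k n * of_bool (w n = cell n x))"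

text \<open>The centred part of the random mass due to the indices in \<open>A\<close>: each
  indicator is taken minus its mean 1 / q n.\<close>

definition fluct :: "nat \<Rightarrow> nat \<Rightarrow> real set \<Rightarrow> (real \<Rightarrow> real) \<Rightarrow> nat set \<Rightarrow> (nat \<Rightarrow> nat) \<Rightarrow> real" where
  "fluct N k P u A w
     = (\<Sum>n\<in>A. \<Sum>y\<in>P. u y * (block_coeff N k n * of_bool (w n = cell n y) - block_coeff N k n / real (q n)))"

lemma block_coeff_nonneg: "0 < block_weight N k \<Longrightarrow> 0 \<le> block_coeff N k n"
  using \<phi>_pos[of "level n"] by (simp add: block_coeff_def)

lemma sum_block_coeff: "0 < block_weight N k \<Longrightarrow> (\<Sum>n\<in>{N..<N + k}. block_coeff N k n / real (q n)) = 1"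
proof -
  assume t: "0 < block_weight N k"
  have "(\<Sum>n\<in>{N..<N + k}. block_coeff N k n / real (q n)) = (\<Sum>n\<in>{N..<N + k}. 1 / (real (q n) * \<phi> (level n))) / block_weight N k"
    by (simp add: block_coeff_def sum_divide_distrib mult_ac)
  then show ?thesis using t by (simp flip: block_weight_def)
qed

text \<open>The comparison of \<psi> with \<phi> pays for the division by \<phi> in the coefficient;
  the factor 1 / \<open>block_weight\<close> left over makes long blocks harmless.\<close>

lemma block_coeff_\<psi>_le: "0 < block_weight N k \<Longrightarrow> block_coeff N k n * \<psi> (level n) \<le> K / block_weight N k"
  using \<psi>_le[of "level n"] \<phi>_pos[of "level n"] by (simp add: block_coeff_def field_simps)

text \<open>For each index the variance is at most the second moment of the cell masses, and a sum
  of squares is at most the largest term times the total.\<close>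

lemma fluct_square:
  assumes t: "0 < block_weight N k" and P: "finite P" "P \<subseteq> {0..<1}" and A: "A \<subseteq> {N..<N + k}"
    and u: "\<And>y. y \<in> P \<Longrightarrow> 0 \<le> u y"
    and B: "\<And>n c. n \<in> A \<Longrightarrow> (\<Sum>y\<in>P. u y * of_bool (cell n y = c)) \<le> B n"
  shows "Avg N k (\<lambda>w. (fluct N k P u A w)\<^sup>2) w
     \<le> (\<Sum>n\<in>A. block_coeff N k n * (block_coeff N k n / real (q n)) * B n * (\<Sum>y\<in>P. u y))"
proof -
  let ?a = "block_coeff N k"
  define Z where "Z n c = (if n \<in> A then
    \<Sum>y\<in>P. u y * (?a n * of_bool (c = cell n y) - ?a n / real (q n)) else 0)" for n c
  define s where "s n c = (\<Sum>y\<in>P. u y * of_bool (cell n y = c))" for n c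
  define U where "U = (\<Sum>y\<in>P. u y)"
  have Z_s: "Z n c = ?a n * s n c - ?a n * U / real (q n)" if "n \<in> A" for n c
    using that by (simp add: Z_def s_def U_def right_diff_distrib sum_subtractf sum_distrib_left
        sum_distrib_right mult_ac eq_commute[of c] sum_divide_distrib)
  have s_sum: "(\<Sum>c<q n. s n c) = U" for n
  proof -
    have "(\<Sum>c<q n. s n c) = (\<Sum>y\<in>P. u y * (\<Sum>c<q n. of_bool (cell n y = c)))"
      unfolding s_def by (subst sum.swap) (simp only: sum_distrib_left)
    also have "\<dots> = U" unfolding U_def
    proof (rule sum.cong[OF refl])
      fix y assume "y \<in> P"
      then show "u y * (\<Sum>c<q n. of_bool (cell n y = c)) = u y"
        using sum_cell[of y n] P(2) by auto
    qed
    finally show ?thesis .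
  qed
  have s_nonneg: "0 \<le> s n c" for n c
    unfolding s_def by (intro sum_nonneg) (auto simp: u)
  have "(\<Sum>c<q n. Z n c) = 0" for n
  proof (cases "n \<in> A")
    case True
    show ?thesis
      unfolding Z_s[OF True] sum_subtractf sum_distrib_left[symmetric] s_sum
      using q_pos[of n] by simp
  qed (simp add: Z_def)
  from Avg_square_sum[OF this, of N k w]
  have "Avg N k (\<lambda>w. (\<Sum>n\<in>{N..<N + k}. Z n (w n))\<^sup>2) w
      = (\<Sum>n\<in>{N..<N + k}. (\<Sum>c<q n. (Z n c)\<^sup>2) / real (q n))" .
  also have "(\<lambda>w. (\<Sum>n\<in>{N..<N + k}. Z n (w n))\<^sup>2) = (\<lambda>w. (fluct N k P u A w)\<^sup>2)"
    unfolding fluct_def Z_def using A by (simp add: sum.inter_restrict[symmetric] Int_absorb1)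
  also have "(\<Sum>n\<in>{N..<N + k}. (\<Sum>c<q n. (Z n c)\<^sup>2) / real (q n))
      = (\<Sum>n\<in>A. (\<Sum>c<q n. (Z n c)\<^sup>2) / real (q n))"
    using A by (intro sum.mono_neutral_right) (auto simp: Z_def)
  also have "\<dots> \<le> (\<Sum>n\<in>A. ?a n * (?a n / real (q n)) * B n * U)"
  proof (rule sum_mono)
    fix n assume n: "n \<in> A"
    have sq: "(\<Sum>c<q n. (a * s n c - b)\<^sup>2)
        = a\<^sup>2 * (\<Sum>c<q n. (s n c)\<^sup>2) - 2 * a * b * U + real (q n) * b\<^sup>2" for a b
    proof -
      have "(\<Sum>c<q n. (a * s n c - b)\<^sup>2)
        = (\<Sum>c<q n. a\<^sup>2 * (s n c)\<^sup>2 - 2 * a * b * s n c + b\<^sup>2)"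
        by (intro sum.cong) (auto simp: power2_diff power_mult_distrib mult_ac)
      then show ?thesis by (simp add: sum.distrib sum_subtractf s_sum flip: sum_distrib_left)
    qed
    have "(\<Sum>c<q n. (Z n c)\<^sup>2) = (?a n)\<^sup>2 * (\<Sum>c<q n. (s n c)\<^sup>2) - (?a n)\<^sup>2 * U\<^sup>2 / real (q n)"
      unfolding Z_s[OF n] sq using q_pos[of n] by (simp add: power2_eq_square)
    also have "\<dots> \<le> (?a n)\<^sup>2 * (\<Sum>c<q n. (s n c)\<^sup>2)" by simp
    also have "(\<Sum>c<q n. (s n c)\<^sup>2) \<le> (\<Sum>c<q n. B n * s n c)"
      using B[OF n] s_nonneg unfolding power2_eq_square s_def[symmetric]
      by (intro sum_mono mult_right_mono) auto
    also have "\<dots> = B n * U" by (simp add: s_sum flip: sum_distrib_left)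
    finally have "(\<Sum>c<q n. (Z n c)\<^sup>2) \<le> (?a n)\<^sup>2 * (B n * U)" by (simp add: mult_left_mono)
    then have "(\<Sum>c<q n. (Z n c)\<^sup>2) / real (q n) \<le> (?a n)\<^sup>2 * (B n * U) / real (q n)"
      by (rule divide_right_mono) simp
    then show "(\<Sum>c<q n. (Z n c)\<^sup>2) / real (q n) \<le> ?a n * (?a n / real (q n)) * B n * U"
      by (simp add: power2_eq_square mult_ac)
  qed
  finally show ?thesis unfolding U_def .
qed

abbreviation restr :: "nat \<Rightarrow> int \<Rightarrow> (real \<Rightarrow> real) \<Rightarrow> real \<Rightarrow> real" where
  "restr j d m \<equiv> \<lambda>y. m y * of_bool (dyad j y = d)"

text \<open>One of the two coefficients absorbs the \<psi> of the cell mass; the other, divided by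
  \<open>q n\<close>, is a probability weight. The surviving factor \<open>h (level n)\<close> is
  what later permits summation over scales.\<close>

lemma fluct_square_mass_bounded:
  assumes t: "0 < block_weight N k" and P: "finite P" "P \<subseteq> {0..<1}" and A: "A \<subseteq> {N..<N + k}"
    and L: "\<And>n. n \<in> {N..<N + k} \<Longrightarrow> level n \<le> L"
    and m: "mass_bounded P L m D" and D: "0 \<le> D"
  shows "Avg N k (\<lambda>w. (fluct N k P (restr j d m) A w)\<^sup>2) w
     \<le> 5 * D * K / block_weight N k * mass P m j d * (\<Sum>n\<in>A. block_coeff N k n / real (q n) * h (level n))"
proof -
  have m0: "\<And>y. y \<in> P \<Longrightarrow> 0 \<le> m y" using m by (simp add: mass_bounded_def)
  let ?B = "\<lambda>n. 5 * D * (\<psi> (level n) * h (level n))"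
  have "Avg N k (\<lambda>w. (fluct N k P (restr j d m) A w)\<^sup>2) w
     \<le> (\<Sum>n\<in>A. block_coeff N k n * (block_coeff N k n / real (q n)) * ?B n * (\<Sum>y\<in>P. restr j d m y))"
  proof (rule fluct_square[OF t P A])
    show "\<And>y. y \<in> P \<Longrightarrow> 0 \<le> restr j d m y" using m0 by simp
    fix n c assume "n \<in> A"
    then have "(\<Sum>y\<in>P. m y * of_bool (cell n y = c)) \<le> ?B n"
      using cell_mass_le[OF m P _ D] L A by blast
    moreover have "(\<Sum>y\<in>P. restr j d m y * of_bool (cell n y = c))
        \<le> (\<Sum>y\<in>P. m y * of_bool (cell n y = c))"
      by (intro sum_mono mult_right_mono) (auto simp: m0)
    ultimately show "(\<Sum>y\<in>P. restr j d m y * of_bool (cell n y = c)) \<le> ?B n" by linarith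
  qed
  also have "\<dots> \<le> (\<Sum>n\<in>A. 5 * D * K / block_weight N k * mass P m j d * (block_coeff N k n / real (q n) * h (level n)))"
  proof (rule sum_mono)
    fix n
    let ?c = "block_coeff N k n / real (q n) * h (level n) * (5 * D) * mass P m j d"
    have "0 \<le> ?c"
      using block_coeff_nonneg[OF t, of n] h_pos[of "level n"] D mass_nonneg[of P m j d, OF m0] by simp
    then have "block_coeff N k n * \<psi> (level n) * ?c \<le> K / block_weight N k * ?c"
      by (intro mult_right_mono block_coeff_\<psi>_le[OF t])
    then show "block_coeff N k n * (block_coeff N k n / real (q n)) * ?B n * (\<Sum>y\<in>P. restr j d m y)
        \<le> 5 * D * K / block_weight N k * mass P m j d * (block_coeff N k n / real (q n) * h (level n))"
      by (simp add: mass_def[symmetric] mult_ac)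
  qed
  finally show ?thesis by (simp add: sum_distrib_left)
qed

text \<open>Indices in \<open>A\<close> are centred while the others are left as they are, since
  cells much longer than the dyadic interval do not average out over it.\<close>

lemma mass_dens_split:
  assumes "A \<subseteq> {N..<N + k}" "finite P"
  shows "mass P (\<lambda>y. m y * dens N k w y) j d
    = fluct N k P (restr j d m) A w + (\<Sum>n\<in>A. block_coeff N k n / real (q n)) * mass P m j d
      + (\<Sum>n\<in>{N..<N + k} - A. block_coeff N k n * (\<Sum>y\<in>P. restr j d m y * of_bool (w n = cell n y)))"
proof -
  let ?T = "\<lambda>n. block_coeff N k n * (\<Sum>y\<in>P. restr j d m y * of_bool (w n = cell n y))"
  have fin: "finite A" using assms(1) finite_subset by blast
  have "mass P (\<lambda>y. m y * dens N k w y) j d = (\<Sum>n\<in>{N..<N + k}. ?T n)"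
    unfolding mass_def dens_def sum_distrib_left sum_distrib_right
    by (subst sum.swap) (simp add: mult_ac)
  also have "\<dots> = (\<Sum>n\<in>{N..<N + k} - A. ?T n) + (\<Sum>n\<in>A. ?T n)"
    by (rule sum.subset_diff[OF assms(1)]) simp
  also have "(\<Sum>n\<in>A. ?T n)
     = fluct N k P (restr j d m) A w + (\<Sum>n\<in>A. block_coeff N k n / real (q n)) * mass P m j d"
    unfolding fluct_def mass_def right_diff_distrib sum_subtractf
    by (simp add: sum_distrib_left sum_distrib_right sum_product mult_ac sum_subtractf)
  finally show ?thesis by simp
qed

text \<open>At scale 0 the only dyadic interval is all of [0,1), so the total mass is a special case
  of \<open>mass\<close>, here with every index of the block centred.\<close>

lemma total_deviation:
  assumes t: "0 < block_weight N k" and P: "finite P" "P \<subseteq> {0..<1}"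
    and L: "\<And>n. n \<in> {N..<N + k} \<Longrightarrow> level n \<le> L"
    and m: "mass_bounded P L m D" and D: "0 \<le> D" and \<eta>: "0 < \<eta>"
  shows "Avg N k (\<lambda>w. \<bar>(\<Sum>x\<in>P. m x * dens N k w x) - (\<Sum>x\<in>P. m x)\<bar>) w
     \<le> \<eta> + 1 / \<eta> * (5 * D\<^sup>2 * K * \<psi> 0 * (h 0)\<^sup>2 / block_weight N k)"
proof -
  have d0: "(\<Sum>x\<in>P. u x) = mass P u 0 0" for u
    unfolding mass_def using P(2) by (intro sum.cong) (auto simp: dyad_0)
  let ?R = "fluct N k P (restr 0 0 m) {N..<N + k}"
  have eq: "(\<Sum>x\<in>P. m x * dens N k w x) - (\<Sum>x\<in>P. m x) = ?R w" for w
    unfolding d0 by (subst mass_dens_split[OF order.refl P(1)]) (simp add: sum_block_coeff[OF t])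
  have h: "(\<Sum>n\<in>{N..<N + k}. block_coeff N k n / real (q n) * h (level n)) \<le> h 0"
  proof -
    have "(\<Sum>n\<in>{N..<N + k}. block_coeff N k n / real (q n) * h (level n))
        \<le> (\<Sum>n\<in>{N..<N + k}. block_coeff N k n / real (q n) * h 0)"
      by (intro sum_mono mult_left_mono h_antimono divide_nonneg_nonneg block_coeff_nonneg[OF t]) auto
    then show ?thesis unfolding sum_distrib_right[symmetric] sum_block_coeff[OF t] by simp
  qed
  have "Avg N k (\<lambda>w. \<bar>?R w\<bar>) w \<le> Avg N k (\<lambda>w. \<eta> + 1 / \<eta> * (?R w)\<^sup>2) w"
    by (intro Avg_mono abs_le_square \<eta>)
  also have "\<dots> = \<eta> + 1 / \<eta> * Avg N k (\<lambda>w. (?R w)\<^sup>2) w"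
    by (simp only: Avg_plus Avg_cmult Avg_const)
  also have "Avg N k (\<lambda>w. (?R w)\<^sup>2) w \<le> 5 * D * K / block_weight N k * mass P m 0 0
       * (\<Sum>n\<in>{N..<N + k}. block_coeff N k n / real (q n) * h (level n))"
    by (rule fluct_square_mass_bounded[OF t P order.refl L m D])
  also have "\<dots> \<le> 5 * D * K / block_weight N k * (D * (\<psi> 0 * h 0)) * h 0"
    using m t K_pos D h_pos[of 0] \<psi>_pos[of 0] h mass_nonneg[of P m 0 0] block_coeff_nonneg[OF t]
    by (intro mult_mono sum_nonneg) (auto simp: mass_bounded_def less_imp_le[OF h_pos])
  also have "\<dots> = 5 * D\<^sup>2 * K * \<psi> 0 * (h 0)\<^sup>2 / block_weight N k"
    by (simp add: power2_eq_square)
  finally show ?thesis using \<eta> unfolding eq by (simp add: divide_right_mono)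
qed

section \<open>Effect of one block on the maximal function\<close>

definition near :: "nat \<Rightarrow> nat \<Rightarrow> (nat \<Rightarrow> nat) \<Rightarrow> real \<Rightarrow> real" where
  "near N k w x = (\<Sum>n\<in>{N..<N + k}. block_coeff N k n * of_bool (\<bar>int (w n) - int (cell n x)\<bar> \<le> 1))"

text \<open>A dyadic interval around \<open>x\<close> at a scale finer than the cells meets only the
  cell of \<open>x\<close> and its neighbours, hence the 3. Here \<open>near\<close> is the total
  coefficient of the indices that could put mass there.\<close>

lemma Avg_near:
  assumes t: "0 < block_weight N k"
  shows "Avg N k (\<lambda>w. near N k w x) w \<le> 3"
proof -
  let ?u = "\<lambda>n c. of_bool (\<bar>int c - int (cell n x)\<bar> \<le> 1) :: real"
  have "(\<Sum>c<q n. ?u n c) \<le> 3" for n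
  proof -
    have "(\<Sum>c<q n. ?u n c) = real (card {c. c < q n \<and> \<bar>int c - int (cell n x)\<bar> \<le> 1})"
      by (simp add: of_bool_def sum.If_cases Int_def lessThan_def)
    also have "card {c. c < q n \<and> \<bar>int c - int (cell n x)\<bar> \<le> 1}
        \<le> card {cell n x - 1, cell n x, cell n x + 1}"
      by (intro card_mono) auto
    also have "\<dots> \<le> 3" by (simp add: card_insert_if)
    finally show ?thesis by simp
  qed
  note le3 = this
  have "Avg N k (\<lambda>w. near N k w x) w = (\<Sum>n\<in>{N..<N + k}. Avg N k (\<lambda>w. block_coeff N k n * ?u n (w n)) w)"
    unfolding near_def by (subst Avg_sum) auto
  also have "\<dots> = (\<Sum>n\<in>{N..<N + k}. block_coeff N k n * ((\<Sum>c<q n. ?u n c) / real (q n)))"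
    by (intro sum.cong refl) (subst Avg_cmult, subst Avg_single, auto)
  also have "\<dots> \<le> (\<Sum>n\<in>{N..<N + k}. block_coeff N k n * (3 / real (q n)))"
    by (intro sum_mono mult_left_mono divide_right_mono le3 block_coeff_nonneg[OF t]) auto
  also have "\<dots> = 3 * (\<Sum>n\<in>{N..<N + k}. block_coeff N k n / real (q n))"
    by (simp add: sum_distrib_left mult_ac)
  finally show ?thesis by (simp add: sum_block_coeff[OF t])
qed

text \<open>The indices treated as fluctuations at scale \<open>j\<close>. An excluded index has j0
  < j, so the mass bound at scale \<open>j\<close> gives it the small factor
  \<open>\<psi> j0\<close>.\<close>

definition finer :: "nat \<Rightarrow> nat \<Rightarrow> nat \<Rightarrow> nat \<Rightarrow> nat set" where
  "finer N k j0 j = {n \<in> {N..<N + k}. j \<le> j0 \<or> j \<le> level n}"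

lemma mass_dens_le:
  assumes t: "0 < block_weight N k" and P: "finite P" "P \<subseteq> {0..<1}" and m: "mass_bounded P L m D" and D: "0 \<le> D"
    and x: "x \<in> P" and j: "j \<le> L"
  shows "mass P (\<lambda>y. m y * dens N k w y) j (dyad j x)
    \<le> fluct N k P (restr j (dyad j x) m) (finer N k j0 j) w + mass P m j (dyad j x)
      + D * \<psi> j0 * near N k w x * h j"
proof -
  let ?A = "finer N k j0 j" and ?d = "dyad j x"
  have m0: "\<And>y. y \<in> P \<Longrightarrow> 0 \<le> m y" using m by (simp add: mass_bounded_def)
  have M0: "0 \<le> mass P m j ?d" by (rule mass_nonneg) (rule m0)
  have A: "?A \<subseteq> {N..<N + k}" by (auto simp: finer_def)
  have "(\<Sum>n\<in>?A. block_coeff N k n / real (q n)) \<le> (\<Sum>n\<in>{N..<N + k}. block_coeff N k n / real (q n))"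
    using A block_coeff_nonneg[OF t] by (intro sum_mono2) auto
  then have 1: "(\<Sum>n\<in>?A. block_coeff N k n / real (q n)) * mass P m j ?d \<le> mass P m j ?d"
    using M0 mult_right_mono[OF _ M0] by (fastforce simp: sum_block_coeff[OF t])
  let ?nb = "\<lambda>n. of_bool (\<bar>int (w n) - int (cell n x)\<bar> \<le> 1) :: real"
  have "(\<Sum>n\<in>{N..<N + k} - ?A. block_coeff N k n * (\<Sum>y\<in>P. restr j ?d m y * of_bool (w n = cell n y)))
     \<le> (\<Sum>n\<in>{N..<N + k} - ?A. block_coeff N k n * ?nb n * (D * \<psi> j0 * h j))"
  proof (rule sum_mono)
    fix n assume n: "n \<in> {N..<N + k} - ?A"
    then have nj: "level n \<le> j" "j0 \<le> j" by (auto simp: finer_def)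
    have "(\<Sum>y\<in>P. restr j ?d m y * of_bool (w n = cell n y)) \<le> (\<Sum>y\<in>P. ?nb n * restr j ?d m y)"
    proof (rule sum_mono)
      fix y assume y: "y \<in> P"
      then show "restr j ?d m y * of_bool (w n = cell n y) \<le> ?nb n * restr j ?d m y"
        using m0[OF y] dyad_near_cell[of y x n j] P(2) x nj by (auto simp: subset_iff)
    qed
    also have "\<dots> = ?nb n * mass P m j ?d" by (simp only: mass_def sum_distrib_left)
    also have "mass P m j ?d \<le> D * (\<psi> j * h j)" using m j by (simp add: mass_bounded_def)
    also have "\<dots> \<le> D * (\<psi> j0 * h j)"
      using \<psi>_antimono[OF nj(2)] D h_pos[of j] by (intro mult_left_mono mult_right_mono) auto
    finally have "(\<Sum>y\<in>P. restr j ?d m y * of_bool (w n = cell n y)) \<le> ?nb n * (D * (\<psi> j0 * h j))"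
      by (simp add: mult_left_mono)
    from mult_left_mono[OF this block_coeff_nonneg[OF t, of n]]
    show "block_coeff N k n * (\<Sum>y\<in>P. restr j ?d m y * of_bool (w n = cell n y))
       \<le> block_coeff N k n * ?nb n * (D * \<psi> j0 * h j)" by (simp add: mult_ac)
  qed
  also have "\<dots> \<le> (\<Sum>n\<in>{N..<N + k}. block_coeff N k n * ?nb n * (D * \<psi> j0 * h j))"
    using block_coeff_nonneg[OF t] D \<psi>_pos[of j0] h_pos[of j] by (intro sum_mono2) auto
  also have "\<dots> = D * \<psi> j0 * near N k w x * h j"
    by (simp only: near_def sum_distrib_left sum_distrib_right mult_ac)
  finally show ?thesis using 1 unfolding mass_dens_split[OF A P(1)] by linarith
qed

text \<open>A maximum does not commute with averages. The fluctuation at each scale is therefore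
  bounded by \<eta> plus the sum of the squared fluctuations over all scales.\<close>

lemma maxfun_dens_le:
  assumes t: "0 < block_weight N k" and P: "finite P" "P \<subseteq> {0..<1}" and m: "mass_bounded P L m D" and D: "0 \<le> D"
    and x: "x \<in> P" and \<eta>: "0 < \<eta>"
  shows "maxfun P L (\<lambda>y. m y * dens N k w y) x
    \<le> maxfun P L m x + D * \<psi> j0 * near N k w x + \<eta>
      + 1 / \<eta> * (\<Sum>j | sparse j \<and> j \<le> L.
          1 / (h j)\<^sup>2 * (fluct N k P (restr j (dyad j x) m) (finer N k j0 j) w)\<^sup>2)"
proof (rule maxfun_le)
  fix j assume j: "sparse j" "j \<le> L"
  let ?R = "\<lambda>j. fluct N k P (restr j (dyad j x) m) (finer N k j0 j) w"
  have "mass P (\<lambda>y. m y * dens N k w y) j (dyad j x) / h j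
    \<le> (?R j + mass P m j (dyad j x) + D * \<psi> j0 * near N k w x * h j) / h j"
    using mass_dens_le[OF t P m D x j(2)] h_pos[of j] by (intro divide_right_mono) auto
  also have "\<dots> = ?R j / h j + mass P m j (dyad j x) / h j + D * \<psi> j0 * near N k w x"
    using h_pos[of j] by (simp add: add_divide_distrib)
  also have "mass P m j (dyad j x) / h j \<le> maxfun P L m x" by (rule maxfun_ge[OF j])
  also have "?R j / h j \<le> \<eta> + 1 / \<eta> * (?R j / h j)\<^sup>2"
    using abs_le_square[OF \<eta>, of "?R j / h j"] by linarith
  also have "(?R j / h j)\<^sup>2 = 1 / (h j)\<^sup>2 * (?R j)\<^sup>2" by (simp add: power_divide)
  also have "\<dots> \<le> (\<Sum>j | sparse j \<and> j \<le> L. 1 / (h j)\<^sup>2 * (?R j)\<^sup>2)"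
    using j scales_finite[of L]
    by (intro member_le_sum[of j "{j. sparse j \<and> j \<le> L}" "\<lambda>j. 1 / (h j)\<^sup>2 * (?R j)\<^sup>2"]) auto
  finally show "mass P (\<lambda>y. m y * dens N k w y) j (dyad j x) / h j
     \<le> maxfun P L m x + D * \<psi> j0 * near N k w x + \<eta>
      + 1 / \<eta> * (\<Sum>j | sparse j \<and> j \<le> L. 1 / (h j)\<^sup>2 * (?R j)\<^sup>2)"
    using \<eta> by (simp add: divide_right_mono)
qed

text \<open>After exchanging the sums, index \<open>n\<close> meets scales up to \<open>j0\<close>
  and sparse scales up to \<open>level n\<close>. Over the latter 1 / h sums to at most 2 / h (level
  n), which the factor \<open>h (level n)\<close> cancels; the result is free of
  \<open>L\<close>.\<close>

lemma sum_finer_scales: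
  assumes t: "0 < block_weight N k"
  shows "(\<Sum>j | sparse j \<and> j \<le> L. \<Sum>n\<in>finer N k j0 j. block_coeff N k n / real (q n) * h (level n) / h j)
    \<le> (real j0 + 1) * h 0 / h j0 + 2"
proof -
  let ?S = "{j. sparse j \<and> j \<le> L}" and ?w = "\<lambda>n. block_coeff N k n / real (q n)"
  have w0: "0 \<le> ?w n" for n using block_coeff_nonneg[OF t, of n] by simp
  have "(\<Sum>j\<in>?S. \<Sum>n\<in>finer N k j0 j. ?w n * h (level n) / h j)
     = (\<Sum>j\<in>?S. \<Sum>n\<in>{N..<N + k}. if j \<le> j0 \<or> j \<le> level n then ?w n * h (level n) / h j else 0)"
    unfolding finer_def by (intro sum.cong refl sum.inter_filter) simp
  also have "\<dots> = (\<Sum>n\<in>{N..<N + k}. \<Sum>j\<in>?S. if j \<le> j0 \<or> j \<le> level n then ?w n * h (level n) / h j else 0)"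
    by (rule sum.swap)
  also have "\<dots> \<le> (\<Sum>n\<in>{N..<N + k}. ?w n * ((real j0 + 1) * h 0 / h j0 + 2))"
  proof (rule sum_mono)
    fix n
    have "(\<Sum>j\<in>?S. if j \<le> j0 \<or> j \<le> level n then 1 / h j else 0)
        = (\<Sum>j\<in>{j \<in> ?S. j \<le> j0 \<or> j \<le> level n}. 1 / h j)"
      by (rule sum.inter_filter[symmetric]) (rule scales_finite)
    also have "\<dots> \<le> (\<Sum>j\<in>{..j0} \<union> {j. sparse j \<and> j \<le> level n}. 1 / h j)"
      using scales_finite[of "level n"] h_pos by (intro sum_mono2) (auto intro: less_imp_le)
    also have "\<dots> \<le> (\<Sum>j\<in>{..j0}. 1 / h j) + (\<Sum>j | sparse j \<and> j \<le> level n. 1 / h j)"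
      using scales_finite[of "level n"]
      by (subst sum_Un) (auto intro!: sum_nonneg simp: less_imp_le[OF h_pos])
    also have "(\<Sum>j\<in>{..j0}. 1 / h j) \<le> (\<Sum>j\<in>{..j0}. 1 / h j0)"
      using h_pos h_antimono by (intro sum_mono) (auto intro!: frac_le)
    also have "(\<Sum>j | sparse j \<and> j \<le> level n. 1 / h j) \<le> 2 / h (level n)" by (rule sum_sparse)
    finally have "(\<Sum>j\<in>?S. if j \<le> j0 \<or> j \<le> level n then 1 / h j else 0)
        \<le> (real j0 + 1) / h j0 + 2 / h (level n)" by (simp add: add.commute)
    from mult_left_mono[OF this less_imp_le[OF h_pos[of "level n"]]]
    have "h (level n) * (\<Sum>j\<in>?S. if j \<le> j0 \<or> j \<le> level n then 1 / h j else 0)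
        \<le> (real j0 + 1) * h (level n) / h j0 + 2"
      using h_pos[of "level n"] by (simp add: algebra_simps)
    also have "\<dots> \<le> (real j0 + 1) * h 0 / h j0 + 2"
      using h_antimono[of 0 "level n"] h_pos[of j0]
      by (intro add_right_mono divide_right_mono mult_left_mono) auto
    finally have "?w n * (h (level n) * (\<Sum>j\<in>?S. if j \<le> j0 \<or> j \<le> level n then 1 / h j else 0))
        \<le> ?w n * ((real j0 + 1) * h 0 / h j0 + 2)"
      by (rule mult_left_mono[OF _ w0])
    moreover have "(\<Sum>j\<in>?S. if j \<le> j0 \<or> j \<le> level n then ?w n * h (level n) / h j else 0)
       = ?w n * (h (level n) * (\<Sum>j\<in>?S. if j \<le> j0 \<or> j \<le> level n then 1 / h j else 0))"
      unfolding sum_distrib_left by (intro sum.cong) auto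
    ultimately show "(\<Sum>j\<in>?S. if j \<le> j0 \<or> j \<le> level n then ?w n * h (level n) / h j else 0)
      \<le> ?w n * ((real j0 + 1) * h 0 / h j0 + 2)" by simp
  qed
  also have "\<dots> = (real j0 + 1) * h 0 / h j0 + 2"
    unfolding sum_distrib_right[symmetric] sum_block_coeff[OF t] by simp
  finally show ?thesis .
qed

lemma Avg_sum_fluct:
  assumes t: "0 < block_weight N k" and P: "finite P" "P \<subseteq> {0..<1}"
    and L: "\<And>n. n \<in> {N..<N + k} \<Longrightarrow> level n \<le> L"
    and m: "mass_bounded P L m D" and D: "0 \<le> D"
  shows "(\<Sum>j | sparse j \<and> j \<le> L.
        1 / (h j)\<^sup>2 * Avg N k (\<lambda>w. (fluct N k P (restr j (dyad j x) m) (finer N k j0 j) w)\<^sup>2) w)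
    \<le> 5 * D\<^sup>2 * K * \<psi> 0 / block_weight N k * ((real j0 + 1) * h 0 / h j0 + 2)"
proof -
  let ?C = "5 * D\<^sup>2 * K * \<psi> 0 / block_weight N k"
  have C: "0 \<le> ?C" using K_pos \<psi>_pos[of 0] t by simp
  have "(\<Sum>j | sparse j \<and> j \<le> L.
        1 / (h j)\<^sup>2 * Avg N k (\<lambda>w. (fluct N k P (restr j (dyad j x) m) (finer N k j0 j) w)\<^sup>2) w)
     \<le> (\<Sum>j | sparse j \<and> j \<le> L. ?C * (\<Sum>n\<in>finer N k j0 j. block_coeff N k n / real (q n) * h (level n) / h j))"
  proof (rule sum_mono)
    fix j assume "j \<in> {j. sparse j \<and> j \<le> L}"
    then have j: "j \<le> L" by simp
    let ?s = "\<Sum>n\<in>finer N k j0 j. block_coeff N k n / real (q n) * h (level n)"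
    have s0: "0 \<le> ?s" using block_coeff_nonneg[OF t] h_pos by (intro sum_nonneg) (simp add: less_imp_le)
    have "Avg N k (\<lambda>w. (fluct N k P (restr j (dyad j x) m) (finer N k j0 j) w)\<^sup>2) w
       \<le> 5 * D * K / block_weight N k * mass P m j (dyad j x) * ?s"
      by (rule fluct_square_mass_bounded[OF t P _ L m D]) (auto simp: finer_def)
    also have "mass P m j (dyad j x) \<le> D * (\<psi> j * h j)" using m j by (simp add: mass_bounded_def)
    also have "\<dots> \<le> D * (\<psi> 0 * h j)"
      using \<psi>_antimono[of 0 j] D h_pos[of j] by (intro mult_left_mono mult_right_mono) auto
    finally have "Avg N k (\<lambda>w. (fluct N k P (restr j (dyad j x) m) (finer N k j0 j) w)\<^sup>2) w
       \<le> 5 * D * K / block_weight N k * (D * (\<psi> 0 * h j)) * ?s"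
      using D K_pos t s0 by (simp add: mult_left_mono mult_right_mono divide_right_mono)
    then have "1 / (h j)\<^sup>2 * Avg N k (\<lambda>w. (fluct N k P (restr j (dyad j x) m) (finer N k j0 j) w)\<^sup>2) w
       \<le> 1 / (h j)\<^sup>2 * (5 * D * K / block_weight N k * (D * (\<psi> 0 * h j)) * ?s)"
      by (rule mult_left_mono) simp
    \<comment> \<open>The mass bound has used up one of the two factors 1 / h j, leaving exactly the
      one that \<open>sum_finer_scales\<close> can sum.\<close>
    also have "\<dots> = ?C * (?s / h j)" using h_pos[of j] by (simp add: power2_eq_square field_simps)
    finally show "1 / (h j)\<^sup>2 * Avg N k (\<lambda>w. (fluct N k P (restr j (dyad j x) m) (finer N k j0 j) w)\<^sup>2) w
       \<le> ?C * (\<Sum>n\<in>finer N k j0 j. block_coeff N k n / real (q n) * h (level n) / h j)"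
      by (simp only: sum_divide_distrib)
  qed
  also have "\<dots> \<le> ?C * ((real j0 + 1) * h 0 / h j0 + 2)"
    unfolding sum_distrib_left[symmetric] by (rule mult_left_mono[OF sum_finer_scales[OF t] C])
  finally show ?thesis .
qed

text \<open>The free parameter \<open>j0\<close> separates two demands: it is chosen to make
  \<open>\<psi> j0\<close> small, and only then is \<open>block_weight\<close> taken large compared
  with h 0 / h j0.\<close>

lemma Avg_maxfun:
  assumes t: "0 < block_weight N k" and P: "finite P" "P \<subseteq> {0..<1}"
    and L: "\<And>n. n \<in> {N..<N + k} \<Longrightarrow> level n \<le> L"
    and m: "mass_bounded P L m D" and D: "0 \<le> D" and x: "x \<in> P" and \<eta>: "0 < \<eta>"
  shows "Avg N k (\<lambda>w. maxfun P L (\<lambda>y. m y * dens N k w y) x) w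
    \<le> maxfun P L m x + 3 * D * \<psi> j0 + \<eta>
      + 1 / \<eta> * (5 * D\<^sup>2 * K * \<psi> 0 / block_weight N k * ((real j0 + 1) * h 0 / h j0 + 2))"
proof -
  let ?S = "{j. sparse j \<and> j \<le> L}"
  let ?F = "\<lambda>j w. (fluct N k P (restr j (dyad j x) m) (finer N k j0 j) w)\<^sup>2"
  have "Avg N k (\<lambda>w. maxfun P L (\<lambda>y. m y * dens N k w y) x) w
    \<le> Avg N k (\<lambda>w. maxfun P L m x + D * \<psi> j0 * near N k w x + \<eta>
      + 1 / \<eta> * (\<Sum>j\<in>?S. 1 / (h j)\<^sup>2 * ?F j w)) w"
    by (intro Avg_mono maxfun_dens_le[OF t P m D x \<eta>])
  also have "\<dots> = maxfun P L m x + D * \<psi> j0 * Avg N k (\<lambda>w. near N k w x) w + \<eta>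
      + 1 / \<eta> * (\<Sum>j\<in>?S. 1 / (h j)\<^sup>2 * Avg N k (?F j) w)"
    by (simp only: Avg_plus Avg_cmult Avg_const Avg_sum[OF scales_finite])
  also have "\<dots> \<le> maxfun P L m x + D * \<psi> j0 * 3 + \<eta>
      + 1 / \<eta> * (5 * D\<^sup>2 * K * \<psi> 0 / block_weight N k * ((real j0 + 1) * h 0 / h j0 + 2))"
    using D \<psi>_pos[of j0] \<eta>
    by (intro add_mono mult_left_mono Avg_near[OF t] Avg_sum_fluct[OF t P L m D] order.refl) auto
  finally show ?thesis by (simp add: mult_ac)
qed

text \<open>Expanding one factor of the density into its summands and removing the chosen index
  from the other factor decouples the two.\<close>

lemma Avg_potential_dens:
  assumes t: "0 < block_weight N k" and P: "finite P" "P \<subseteq> {0..<1}"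
    and L: "\<And>n. n \<in> {N..<N + k} \<Longrightarrow> level n \<le> L"
    and m: "mass_bounded P L m D" and D: "0 \<le> D"
  shows "Avg N k (\<lambda>w. potential P L (\<lambda>y. m y * dens N k w y)) w
    \<le> (\<Sum>x\<in>P. m x * (5 * D * K / block_weight N k + Avg N k (\<lambda>w. maxfun P L (\<lambda>y. m y * dens N k w y) x) w))"
proof -
  \<comment> \<open>\<open>E\<close> bounds what a single index can add to the maximal
    function.\<close>
  define E where "E = 5 * D * K / block_weight N k"
  have m0: "\<And>y. y \<in> P \<Longrightarrow> 0 \<le> m y" using m by (simp add: mass_bounded_def)
  let ?M = "\<lambda>w x. maxfun P L (\<lambda>y. m y * dens N k w y) x"
  define dn where "dn n w y = (\<Sum>i\<in>{N..<N + k} - {n}. block_coeff N k i * of_bool (w i = cell i y))" for n w y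
  let ?N = "\<lambda>n w x. maxfun P L (\<lambda>y. m y * dn n w y) x"
  have dens_dn: "dens N k w y = block_coeff N k n * of_bool (w n = cell n y) + dn n w y"
    if "n \<in> {N..<N + k}" for n w y
    unfolding dens_def dn_def using that by (subst sum.remove[of _ n]) auto
  have step: "?M w x \<le> E + ?N n w x" if n: "n \<in> {N..<N + k}" and x: "x \<in> P" for n w x
  proof (rule maxfun_le)
    fix j assume j: "sparse j" "j \<le> L"
    let ?s = "\<Sum>y\<in>P. m y * of_bool (cell n y = w n) * of_bool (dyad j y = dyad j x)"
    have eq: "mass P (\<lambda>y. m y * dens N k w y) j (dyad j x)
        = block_coeff N k n * ?s + mass P (\<lambda>y. m y * dn n w y) j (dyad j x)"
      unfolding mass_def dens_dn[OF n]
      by (simp add: sum_distrib_left algebra_simps sum.distrib eq_commute[of "w n"])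
    \<comment> \<open>The intersection of a cell with a dyadic interval obeys the bound at the finer
      of the two scales. Monotonicity then allows \<psi> to be read at \<open>level n\<close>, where
      the coefficient cancels it, and h at \<open>j\<close>, by which the mass is divided.\<close>
    have "?s \<le> 5 * D * (\<psi> (max j (level n)) * h (max j (level n)))"
    proof (cases "level n \<le> j")
      case True
      have "?s \<le> mass P m j (dyad j x)"
        unfolding mass_def by (intro sum_mono mult_right_mono) (auto simp: m0)
      also have "\<dots> \<le> D * (\<psi> j * h j)" using m j by (simp add: mass_bounded_def)
      also have "\<dots> \<le> 5 * D * (\<psi> j * h j)"
        using D \<psi>_pos[of j] h_pos[of j] by (intro mult_right_mono) auto
      finally show ?thesis using True by (simp add: max_def)
    next
      case False
      have "?s \<le> (\<Sum>y\<in>P. m y * of_bool (cell n y = w n))"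
        by (intro sum_mono) (auto simp: m0)
      also have "\<dots> \<le> 5 * D * (\<psi> (level n) * h (level n))"
        by (rule cell_mass_le[OF m P L[OF n] D])
      finally show ?thesis using False by (simp add: max_def)
    qed
    also have "\<dots> \<le> 5 * D * (\<psi> (level n) * h j)"
      using D less_imp_le[OF \<psi>_pos] less_imp_le[OF h_pos]
      by (intro mult_left_mono mult_mono \<psi>_antimono h_antimono) auto
    finally have "block_coeff N k n * ?s \<le> block_coeff N k n * (5 * D * (\<psi> (level n) * h j))"
      by (rule mult_left_mono[OF _ block_coeff_nonneg[OF t]])
    also have "\<dots> = block_coeff N k n * \<psi> (level n) * (5 * D * h j)" by simp
    also have "\<dots> \<le> K / block_weight N k * (5 * D * h j)"
      using D h_pos[of j] by (intro mult_right_mono block_coeff_\<psi>_le[OF t]) auto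
    also have "\<dots> = E * h j" by (simp add: E_def)
    finally have "mass P (\<lambda>y. m y * dens N k w y) j (dyad j x) / h j
        \<le> (E * h j + mass P (\<lambda>y. m y * dn n w y) j (dyad j x)) / h j"
      unfolding eq using h_pos[of j] by (intro divide_right_mono) auto
    also have "\<dots> = E + mass P (\<lambda>y. m y * dn n w y) j (dyad j x) / h j"
      using h_pos[of j] by (simp add: add_divide_distrib)
    also have "\<dots> \<le> E + ?N n w x" by (intro add_left_mono maxfun_ge j)
    finally show "mass P (\<lambda>y. m y * dens N k w y) j (dyad j x) / h j \<le> E + ?N n w x" .
  qed
  have ind: "indep_of n (\<lambda>w. E + ?N n w x)" for n x
  proof -
    have "dn n (w(n := c)) = dn n w" for w c
      unfolding dn_def by (intro ext sum.cong) auto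
    then show ?thesis by (simp add: indep_of_def)
  qed
  have "Avg N k (\<lambda>w. of_bool (w n = cell n x) * ?M w x) w
      \<le> 1 / real (q n) * (E + Avg N k (\<lambda>w. ?M w x) w)"
    if n: "n \<in> {N..<N + k}" and x: "x \<in> P" for n x
  proof -
    have "Avg N k (\<lambda>w. of_bool (w n = cell n x) * ?M w x) w
        \<le> Avg N k (\<lambda>w. of_bool (w n = cell n x) * (E + ?N n w x)) w"
      by (intro Avg_mono mult_left_mono step n x) auto
    also have "\<dots> = (\<Sum>c<q n. of_bool (c = cell n x)) / real (q n) * Avg N k (\<lambda>w. E + ?N n w x) w"
      by (rule Avg_factor[OF n ind])
    also have "(\<Sum>c<q n. of_bool (c = cell n x) :: real) = 1"
      using sum_cell[of x n] x P(2) by (auto simp: eq_commute[of _ "cell n x"])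
    \<comment> \<open>Once factored out, the index may be put back, which only enlarges the mass;
      all indices then share one bound.\<close>
    also have "Avg N k (\<lambda>w. E + ?N n w x) w \<le> Avg N k (\<lambda>w. E + ?M w x) w"
    proof (rule Avg_mono)
      fix w
      have "?N n w x \<le> ?M w x"
      proof (rule maxfun_le)
        fix j assume j: "sparse j" "j \<le> L"
        have "mass P (\<lambda>y. m y * dn n w y) j (dyad j x) \<le> mass P (\<lambda>y. m y * dens N k w y) j (dyad j x)"
          using block_coeff_nonneg[OF t] m0 by (intro mass_mono mult_left_mono) (auto simp: dens_dn[OF n])
        then have "mass P (\<lambda>y. m y * dn n w y) j (dyad j x) / h j
            \<le> mass P (\<lambda>y. m y * dens N k w y) j (dyad j x) / h j"
          using h_pos[of j] by (intro divide_right_mono) auto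
        also have "\<dots> \<le> ?M w x" by (rule maxfun_ge[OF j])
        finally show "mass P (\<lambda>y. m y * dn n w y) j (dyad j x) / h j \<le> ?M w x" .
      qed
      then show "E + ?N n w x \<le> E + ?M w x" by simp
    qed
    finally show ?thesis using q_pos[of n] by (simp add: Avg_plus divide_right_mono)
  qed
  note one = this
  have "Avg N k (\<lambda>w. potential P L (\<lambda>y. m y * dens N k w y)) w
     = Avg N k (\<lambda>w. \<Sum>x\<in>P. \<Sum>n\<in>{N..<N + k}. m x * block_coeff N k n * (of_bool (w n = cell n x) * ?M w x)) w"
    unfolding potential_def by (subst (1) dens_def) (simp only: sum_distrib_left sum_distrib_right mult_ac)
  also have "\<dots> = (\<Sum>x\<in>P. \<Sum>n\<in>{N..<N + k}. m x * block_coeff N k n * Avg N k (\<lambda>w. of_bool (w n = cell n x) * ?M w x) w)"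
    by (simp only: Avg_sum[OF P(1)] Avg_sum[OF finite_atLeastLessThan] Avg_cmult)
  also have "\<dots> \<le> (\<Sum>x\<in>P. \<Sum>n\<in>{N..<N + k}. m x * block_coeff N k n * (1 / real (q n) * (E + Avg N k (\<lambda>w. ?M w x) w)))"
    using m0 block_coeff_nonneg[OF t] by (intro sum_mono mult_left_mono one) auto
  also have "\<dots> = (\<Sum>x\<in>P. (\<Sum>n\<in>{N..<N + k}. block_coeff N k n / real (q n)) * (m x * (E + Avg N k (\<lambda>w. ?M w x) w)))"
    unfolding sum_distrib_right by (simp add: mult_ac)
  finally show ?thesis by (simp add: sum_block_coeff[OF t] E_def)
qed

end

section \<open>Iterating over blocks of indices\<close>

context weighted_blocks begin

lemma block_weight_unbounded: "\<exists>k. B \<le> block_weight N k"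
proof (rule ccontr)
  assume "\<nexists>k. B \<le> block_weight N k"
  then have B: "block_weight N k < B" for k by (auto simp: not_le)
  let ?f = "\<lambda>n. 1 / (real (q n) * \<phi> (level n))"
  have "(\<Sum>i<k. ?f (i + N)) = block_weight N k" for k
    unfolding block_weight_def using sum.shift_bounds_nat_ivl[of ?f 0 N k]
    by (simp add: atLeast0LessThan add.commute)
  then have "summable (\<lambda>i. ?f (i + N))"
    using B \<phi>_pos by (intro summableI_nonneg_bounded[of _ B]) (auto simp: less_imp_le)
  then show False using diverges summable_iff_shift[of ?f N] by simp
qed

text \<open>The quantifiers over \<open>P\<close>, \<open>L\<close>, \<open>m\<close> and
  \<open>w\<close> are inside, so one deterministic block serves every past and every resolution.
  \<open>D'\<close> is the constant of the mass bound after the block.\<close>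

definition good_block :: "nat \<Rightarrow> nat \<Rightarrow> real \<Rightarrow> real \<Rightarrow> real \<Rightarrow> bool" where
  "good_block N k D D' \<epsilon> \<longleftrightarrow> 0 < block_weight N k \<and> 0 < D \<and> (\<forall>w x. D * dens N k w x \<le> D') \<and>
    (\<forall>P L m w. finite P \<longrightarrow> P \<subseteq> {0..<1} \<longrightarrow> (\<forall>n\<in>{N..<N + k}. level n \<le> L) \<longrightarrow> mass_bounded P L m D \<longrightarrow>
      Avg N k (\<lambda>w. potential P L (\<lambda>x. m x * dens N k w x)) w \<le> potential P L m + \<epsilon> \<and>
      Avg N k (\<lambda>w. \<bar>(\<Sum>x\<in>P. m x * dens N k w x) - (\<Sum>x\<in>P. m x)\<bar>) w \<le> \<epsilon>)"

lemma dens_nonneg: "0 < block_weight N k \<Longrightarrow> 0 \<le> dens N k w x"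
  unfolding dens_def using block_coeff_nonneg by (intro sum_nonneg) auto

lemma good_block_exists:
  assumes D: "0 < D" and \<epsilon>: "0 < \<epsilon>"
  shows "\<exists>k D'. 0 < D' \<and> good_block N k D D' \<epsilon>"
proof -
  define T where "T = D * (\<psi> 0 * h 0)"
  have T: "0 < T" using D \<psi>_pos[of 0] h_pos[of 0] by (simp add: T_def)
  \<comment> \<open>Three errors of size \<eta> will occur, each multiplied by a total mass of at
    most \<open>T\<close>: together 3 * \<eta> * T = 3 * \<epsilon> / 4.\<close>
  define \<eta> where "\<eta> = \<epsilon> / (4 * T)"
  have \<eta>: "0 < \<eta>" using \<epsilon> T by (simp add: \<eta>_def)
  have "eventually (\<lambda>j. \<psi> j < \<eta> / (3 * D)) sequentially"
    using \<psi>_lim \<eta> D by (intro order_tendstoD(2)) auto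
  then obtain j0 where "\<psi> j0 < \<eta> / (3 * D)" by (auto simp: eventually_sequentially)
  then have j0: "3 * D * \<psi> j0 \<le> \<eta>" using D by (simp add: field_simps)
  \<comment> \<open>\<open>A\<close> and \<open>A'\<close> collect the numerators of all terms
    divided by \<open>block_weight\<close>, for the potential and for the total mass.\<close>
  define A where "A = 5 * D * K + 1 / \<eta> * (5 * D\<^sup>2 * K * \<psi> 0 * ((real j0 + 1) * h 0 / h j0 + 2))"
  define A' where "A' = 1 / (\<epsilon> / 2) * (5 * D\<^sup>2 * K * \<psi> 0 * (h 0)\<^sup>2)"
  obtain k where k: "max 1 (max (A / \<eta>) (A' / (\<epsilon> / 2))) \<le> block_weight N k" using block_weight_unbounded by blast
  then have t: "0 < block_weight N k" by simp
  from k have k: "A / \<eta> \<le> block_weight N k" "A' / (\<epsilon> / 2) \<le> block_weight N k" by simp_all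
  then have A: "A / block_weight N k \<le> \<eta>" "A' / block_weight N k \<le> \<epsilon> / 2"
    using t \<eta> \<epsilon> by (simp_all add: field_simps)
  define D' where "D' = D * (1 + (\<Sum>n\<in>{N..<N + k}. block_coeff N k n))"
  have sco: "0 \<le> (\<Sum>n\<in>{N..<N + k}. block_coeff N k n)" by (intro sum_nonneg block_coeff_nonneg[OF t])
  have D': "0 < D'" using D sco by (simp add: D'_def)
  have dens_D': "D * dens N k w x \<le> D'" for w x
  proof -
    have "dens N k w x \<le> (\<Sum>n\<in>{N..<N + k}. block_coeff N k n)"
      unfolding dens_def by (intro sum_mono) (auto simp: block_coeff_nonneg[OF t])
    then show ?thesis using D by (simp add: D'_def)
  qed
  have exp: "Avg N k (\<lambda>w. potential P L (\<lambda>x. m x * dens N k w x)) w \<le> potential P L m + \<epsilon>"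
    "Avg N k (\<lambda>w. \<bar>(\<Sum>x\<in>P. m x * dens N k w x) - (\<Sum>x\<in>P. m x)\<bar>) w \<le> \<epsilon>"
    if P: "finite P" "P \<subseteq> {0..<1}" and L: "\<forall>n\<in>{N..<N + k}. level n \<le> L" and m: "mass_bounded P L m D"
    for P L m w
  proof -
    have L': "\<And>n. n \<in> {N..<N + k} \<Longrightarrow> level n \<le> L" using L by auto
    have D0: "0 \<le> D" using D by simp
    have m0: "\<And>y. y \<in> P \<Longrightarrow> 0 \<le> m y" using m by (simp add: mass_bounded_def)
    have "Avg N k (\<lambda>w. potential P L (\<lambda>y. m y * dens N k w y)) w
      \<le> (\<Sum>x\<in>P. m x * (5 * D * K / block_weight N k + Avg N k (\<lambda>w. maxfun P L (\<lambda>y. m y * dens N k w y) x) w))"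
      by (rule Avg_potential_dens[OF t P L' m D0])
    also have "\<dots> \<le> (\<Sum>x\<in>P. m x * (maxfun P L m x + 3 * \<eta>))"
    proof (intro sum_mono mult_left_mono m0)
      fix x assume x: "x \<in> P"
      have "5 * D * K / block_weight N k + 1 / \<eta> * (5 * D\<^sup>2 * K * \<psi> 0 / block_weight N k * ((real j0 + 1) * h 0 / h j0 + 2))
          = A / block_weight N k" by (simp add: A_def add_divide_distrib)
      then show "5 * D * K / block_weight N k + Avg N k (\<lambda>w. maxfun P L (\<lambda>y. m y * dens N k w y) x) w
          \<le> maxfun P L m x + 3 * \<eta>"
        using Avg_maxfun[OF t P L' m D0 x \<eta>, of w j0] A(1) j0 by linarith
    qed
    also have "\<dots> = potential P L m + 3 * \<eta> * (\<Sum>x\<in>P. m x)"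
      unfolding potential_def sum_distrib_left sum.distrib[symmetric]
      by (intro sum.cong) (auto simp: algebra_simps)
    also have "3 * \<eta> * (\<Sum>x\<in>P. m x) \<le> 3 * \<eta> * T"
      using mass_bounded_total[OF m P(2)] \<eta> by (intro mult_left_mono) (auto simp: T_def)
    also have "\<dots> \<le> \<epsilon>" using T \<epsilon> by (simp add: \<eta>_def)
    finally show "Avg N k (\<lambda>w. potential P L (\<lambda>x. m x * dens N k w x)) w \<le> potential P L m + \<epsilon>" by simp
    have "1 / (\<epsilon> / 2) * (5 * D\<^sup>2 * K * \<psi> 0 * (h 0)\<^sup>2 / block_weight N k) = A' / block_weight N k"
      by (simp add: A'_def)
    then show "Avg N k (\<lambda>w. \<bar>(\<Sum>x\<in>P. m x * dens N k w x) - (\<Sum>x\<in>P. m x)\<bar>) w \<le> \<epsilon>"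
      using total_deviation[OF t P L' m D0, of "\<epsilon> / 2" w] \<epsilon> A(2) by linarith
  qed
  have "good_block N k D D' \<epsilon>"
    unfolding good_block_def by (intro conjI allI impI t D dens_D' exp)
  with D' show ?thesis by blast
qed

definition block_seq :: "(nat \<Rightarrow> nat) \<Rightarrow> (nat \<Rightarrow> real) \<Rightarrow> (nat \<Rightarrow> real) \<Rightarrow> bool" where
  "block_seq N D \<epsilon> \<longleftrightarrow> N 0 = 0 \<and> D 0 = 1 \<and>
     (\<forall>s. N s \<le> N (Suc s) \<and> good_block (N s) (N (Suc s) - N s) (D s) (D (Suc s)) (\<epsilon> s))"

lemma block_seq_exists:
  assumes "\<And>s. 0 < \<epsilon> s"
  shows "\<exists>N D. block_seq N D \<epsilon>"
proof -
  let ?P = "\<lambda>s (x :: nat \<times> real). 0 < snd x \<and> (s = (0::nat) \<longrightarrow> fst x = 0 \<and> snd x = 1)"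
  let ?Q = "\<lambda>s x y. fst x \<le> fst y \<and> good_block (fst x) (fst y - fst x) (snd x) (snd y) (\<epsilon> s)"
  have "\<exists>f. \<forall>s. ?P s (f s) \<and> ?Q s (f s) (f (Suc s))"
  proof (rule dependent_nat_choice)
    show "\<exists>x. ?P 0 x" by (intro exI[of _ "(0, 1)"]) auto
    fix x s assume "?P s x"
    then obtain k D' where "0 < D'" "good_block (fst x) k (snd x) D' (\<epsilon> s)"
      using good_block_exists[of "snd x" "\<epsilon> s" "fst x"] assms by auto
    then show "\<exists>y. ?P (Suc s) y \<and> ?Q s x y"
      by (intro exI[of _ "(fst x + k, D')"]) auto
  qed
  then obtain f where f: "\<forall>s. ?P s (f s) \<and> ?Q s (f s) (f (Suc s))" by (rule exE)
  have "block_seq (\<lambda>s. fst (f s)) (\<lambda>s. snd (f s)) \<epsilon>"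
    unfolding block_seq_def using f by simp
  then show ?thesis by blast
qed

section \<open>Densities over several blocks\<close>

definition pdens :: "(nat \<Rightarrow> nat) \<Rightarrow> nat \<Rightarrow> (nat \<Rightarrow> nat) \<Rightarrow> real \<Rightarrow> real" where
  "pdens N s w x = (\<Prod>i<s. dens (N i) (N (Suc i) - N i) w x)"

lemma block_seq_mono: "block_seq N D \<epsilon> \<Longrightarrow> s \<le> s' \<Longrightarrow> N s \<le> N s'"
  by (rule lift_Suc_mono_le[of N]) (auto simp: block_seq_def)

lemma pdens_agree:
  assumes "block_seq N D \<epsilon>" "\<And>i. i < N s \<Longrightarrow> w i = w' i"
  shows "pdens N s w = pdens N s w'"
  unfolding pdens_def dens_def
proof (intro ext prod.cong sum.cong refl)
  fix x i n assume "i \<in> {..<s}" "n \<in> {N i..<N i + (N (Suc i) - N i)}"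
  moreover have "N i \<le> N (Suc i)" using assms(1) by (simp add: block_seq_def)
  moreover have "N (Suc i) \<le> N s" using block_seq_mono[OF assms(1), of "Suc i" s] calculation by simp
  ultimately have "w n = w' n" by (intro assms(2)) auto
  then show "block_coeff (N i) (N (Suc i) - N i) n * of_bool (w n = cell n x) =
         block_coeff (N i) (N (Suc i) - N i) n * of_bool (w' n = cell n x)" by simp
qed

lemma mass_bounded_pdens:
  assumes "block_seq N D \<epsilon>" "mass_bounded P L m 1"
  shows "mass_bounded P L (\<lambda>x. m x * pdens N s w x) (D s)"
proof (induction s)
  case 0
  then show ?case using assms by (simp add: pdens_def block_seq_def)
next
  case (Suc s)
  let ?d = "dens (N s) (N (Suc s) - N s) w"
  have gb: "good_block (N s) (N (Suc s) - N s) (D s) (D (Suc s)) (\<epsilon> s)"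
    using assms(1) by (simp add: block_seq_def)
  then have D: "0 < D s" and d0: "\<And>x. 0 \<le> ?d x" and d1: "\<And>x. ?d x \<le> D (Suc s) / D s"
    using dens_nonneg by (auto simp: good_block_def field_simps)
  have m0: "0 \<le> m x * pdens N s w x" if "x \<in> P" for x using Suc that by (auto simp: mass_bounded_def)
  have eq: "m x * pdens N (Suc s) w x = m x * pdens N s w x * ?d x" for x
    by (simp add: pdens_def)
  show ?case unfolding mass_bounded_def eq
  proof (intro conjI ballI allI impI)
    fix x assume "x \<in> P"
    then show "0 \<le> m x * pdens N s w x * ?d x" using m0 d0 by simp
  next
    fix j d assume j: "j \<le> L"
    have "mass P (\<lambda>x. m x * pdens N s w x * ?d x) j d
       \<le> mass P (\<lambda>x. m x * pdens N s w x * (D (Suc s) / D s)) j d"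
      by (intro mass_mono mult_left_mono d1 m0)
    also have "\<dots> = D (Suc s) / D s * mass P (\<lambda>x. m x * pdens N s w x) j d"
      unfolding mass_def sum_distrib_left by (simp add: mult_ac)
    also have "\<dots> \<le> D (Suc s) / D s * (D s * (\<psi> j * h j))"
      using Suc j order_trans[OF d0 d1] by (intro mult_left_mono) (auto simp: mass_bounded_def)
    finally show "mass P (\<lambda>x. m x * pdens N s w x * ?d x) j d \<le> D (Suc s) * (\<psi> j * h j)"
      using D by simp
  qed
qed

text \<open>For a frozen past the weighted masses obey the bound with constant \<open>D s\<close>,
  so the block estimate applies to the inner average, and the errors add up.\<close>

lemma Avg_iterate:
  assumes bs: "block_seq N D \<epsilon>" and P: "finite P" "P \<subseteq> {0..<1}" and m: "mass_bounded P L m 1"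
    and L: "\<forall>n<N s. level n \<le> L"
  shows "Avg 0 (N s) (\<lambda>w. potential P L (\<lambda>x. m x * pdens N s w x)) w \<le> potential P L m + (\<Sum>i<s. \<epsilon> i)
    \<and> Avg 0 (N s) (\<lambda>w. \<bar>(\<Sum>x\<in>P. m x * pdens N s w x) - (\<Sum>x\<in>P. m x)\<bar>) w \<le> (\<Sum>i<s. \<epsilon> i)"
  using L
proof (induction s)
  case 0
  then show ?case using bs by (simp add: block_seq_def pdens_def)
next
  case (Suc s)
  define k where "k = N (Suc s) - N s"
  have N: "N (Suc s) = N s + k" using bs by (simp add: block_seq_def k_def)
  have gb: "good_block (N s) k (D s) (D (Suc s)) (\<epsilon> s)"
    using bs by (simp add: block_seq_def k_def)
  have IH: "Avg 0 (N s) (\<lambda>w. potential P L (\<lambda>x. m x * pdens N s w x)) w \<le> potential P L m + (\<Sum>i<s. \<epsilon> i)"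
      "Avg 0 (N s) (\<lambda>w. \<bar>(\<Sum>x\<in>P. m x * pdens N s w x) - (\<Sum>x\<in>P. m x)\<bar>) w \<le> (\<Sum>i<s. \<epsilon> i)"
    using Suc by (simp_all add: N)
  have L': "\<forall>n\<in>{N s..<N s + k}. level n \<le> L" using Suc.prems by (simp add: N)
  let ?m = "\<lambda>w x. m x * pdens N s w x"
  have eq: "m x * pdens N (Suc s) w x = ?m w x * dens (N s) k w x" for w x
    by (simp add: pdens_def k_def)
  have gbw: "Avg (N s) k (\<lambda>w'. potential P L (\<lambda>x. ?m w x * dens (N s) k w' x)) w \<le> potential P L (?m w) + \<epsilon> s"
      "Avg (N s) k (\<lambda>w'. \<bar>(\<Sum>x\<in>P. ?m w x * dens (N s) k w' x) - (\<Sum>x\<in>P. ?m w x)\<bar>) w \<le> \<epsilon> s" for w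
    using gb P L' mass_bounded_pdens[OF bs m, of s w] by (auto simp: good_block_def)
  have "Avg 0 (N (Suc s)) (\<lambda>w. potential P L (\<lambda>x. m x * pdens N (Suc s) w x)) w
     = Avg 0 (N s) (Avg (N s) k (\<lambda>w'. potential P L (\<lambda>x. ?m w' x * dens (N s) k w' x))) w"
    unfolding N Avg_add_blocks eq by simp
  also have "\<dots> \<le> Avg 0 (N s) (\<lambda>w. potential P L (?m w) + \<epsilon> s) w"
  proof (rule Avg_mono)
    fix w
    have "Avg (N s) k (\<lambda>w'. potential P L (\<lambda>x. ?m w' x * dens (N s) k w' x)) w
       \<le> Avg (N s) k (\<lambda>w'. potential P L (\<lambda>x. ?m w x * dens (N s) k w' x)) w"
    proof (rule Avg_mono_agree)
      fix w' assume "\<And>i. i < N s \<Longrightarrow> w' i = w i"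
      then have "pdens N s w' = pdens N s w" by (rule pdens_agree[OF bs])
      then show "potential P L (\<lambda>x. ?m w' x * dens (N s) k w' x) \<le> potential P L (\<lambda>x. ?m w x * dens (N s) k w' x)"
        by simp
    qed
    then show "Avg (N s) k (\<lambda>w'. potential P L (\<lambda>x. ?m w' x * dens (N s) k w' x)) w \<le> potential P L (?m w) + \<epsilon> s"
      using gbw(1)[of w] by linarith
  qed
  also have "\<dots> \<le> potential P L m + (\<Sum>i<Suc s. \<epsilon> i)" using IH(1) by (simp add: Avg_plus)
  finally have 1: "Avg 0 (N (Suc s)) (\<lambda>w. potential P L (\<lambda>x. m x * pdens N (Suc s) w x)) w
      \<le> potential P L m + (\<Sum>i<Suc s. \<epsilon> i)" .
  let ?dev = "\<lambda>w. \<bar>(\<Sum>x\<in>P. ?m w x) - (\<Sum>x\<in>P. m x)\<bar>"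
  have "Avg 0 (N (Suc s)) (\<lambda>w. \<bar>(\<Sum>x\<in>P. m x * pdens N (Suc s) w x) - (\<Sum>x\<in>P. m x)\<bar>) w
     = Avg 0 (N s) (Avg (N s) k (\<lambda>w'. \<bar>(\<Sum>x\<in>P. ?m w' x * dens (N s) k w' x) - (\<Sum>x\<in>P. m x)\<bar>)) w"
    unfolding N Avg_add_blocks eq by simp
  also have "\<dots> \<le> Avg 0 (N s) (\<lambda>w. \<epsilon> s + ?dev w) w"
  proof (rule Avg_mono)
    fix w
    have "Avg (N s) k (\<lambda>w'. \<bar>(\<Sum>x\<in>P. ?m w' x * dens (N s) k w' x) - (\<Sum>x\<in>P. m x)\<bar>) w
       \<le> Avg (N s) k (\<lambda>w'. \<bar>(\<Sum>x\<in>P. ?m w x * dens (N s) k w' x) - (\<Sum>x\<in>P. ?m w x)\<bar> + ?dev w) w"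
    proof (rule Avg_mono_agree)
      fix w' assume "\<And>i. i < N s \<Longrightarrow> w' i = w i"
      then have "pdens N s w' = pdens N s w" by (rule pdens_agree[OF bs])
      then show "\<bar>(\<Sum>x\<in>P. ?m w' x * dens (N s) k w' x) - (\<Sum>x\<in>P. m x)\<bar>
        \<le> \<bar>(\<Sum>x\<in>P. ?m w x * dens (N s) k w' x) - (\<Sum>x\<in>P. ?m w x)\<bar> + ?dev w" by simp
    qed
    also have "\<dots> = Avg (N s) k (\<lambda>w'. \<bar>(\<Sum>x\<in>P. ?m w x * dens (N s) k w' x) - (\<Sum>x\<in>P. ?m w x)\<bar>) w + ?dev w"
      by (simp add: Avg_plus)
    finally show "Avg (N s) k (\<lambda>w'. \<bar>(\<Sum>x\<in>P. ?m w' x * dens (N s) k w' x) - (\<Sum>x\<in>P. m x)\<bar>) w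
        \<le> \<epsilon> s + ?dev w"
      using gbw(2)[of w] by linarith
  qed
  also have "\<dots> \<le> (\<Sum>i<Suc s. \<epsilon> i)" using IH(2) by (simp add: Avg_plus)
  finally show ?case using 1 by simp
qed

section \<open>Costs of dyadic covers\<close>

lemma cover_cost_ge:
  assumes P: "finite P" and m0: "\<And>x. x \<in> P \<Longrightarrow> 0 \<le> m x"
    and c0: "0 < c0" and b: "0 < b" and block_weight: "c0 / 2 \<le> (\<Sum>x\<in>P. m x)" and potential: "potential P L m \<le> b"
    and C: "finite C" "\<And>j d. (j, d) \<in> C \<Longrightarrow> j \<le> L"
    and cov: "\<And>x. x \<in> P \<Longrightarrow> 0 < m x \<Longrightarrow> \<exists>(j, d)\<in>C. dyad j x = d"
  shows "c0\<^sup>2 / (32 * b) \<le> (\<Sum>(j, d)\<in>C. h j)"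
proof -
  \<comment> \<open>By Chebyshev's inequality the points outside \<open>Y\<close> carry mass at most
    c0 / 4, so at least c0 / 4 remains on \<open>Y\<close>.\<close>
  define Y where "Y = {x \<in> P. maxfun P L m x \<le> 4 * b / c0}"
  have Y: "Y \<subseteq> P" "finite Y" using P by (auto simp: Y_def)
  have "4 * b / c0 * (\<Sum>x\<in>P - Y. m x) = (\<Sum>x\<in>P - Y. m x * (4 * b / c0))"
    unfolding sum_distrib_left by (intro sum.cong) auto
  also have "\<dots> \<le> (\<Sum>x\<in>P - Y. m x * maxfun P L m x)"
    using m0 by (intro sum_mono mult_left_mono) (auto simp: Y_def)
  also have "\<dots> \<le> potential P L m"
    unfolding potential_def using P m0 maxfun_nonneg[of P m] by (intro sum_mono2) auto
  finally have "4 * b / c0 * (\<Sum>x\<in>P - Y. m x) \<le> b" using potential by simp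
  then have "(\<Sum>x\<in>P - Y. m x) \<le> c0 / 4" using c0 b by (simp add: field_simps)
  moreover have "(\<Sum>x\<in>P. m x) = (\<Sum>x\<in>P - Y. m x) + (\<Sum>x\<in>Y. m x)"
    by (rule sum.subset_diff[OF Y(1) P])
  ultimately have "c0 / 4 \<le> (\<Sum>x\<in>Y. m x)" using block_weight by linarith
  also have "\<dots> \<le> (\<Sum>x\<in>Y. \<Sum>(j, d)\<in>C. m x * of_bool (dyad j x = d))"
  proof (rule sum_mono)
    fix x assume "x \<in> Y"
    then have x: "x \<in> P" using Y by auto
    show "m x \<le> (\<Sum>(j, d)\<in>C. m x * of_bool (dyad j x = d))"
    proof (cases "0 < m x")
      case True
      then obtain j where "(j, dyad j x) \<in> C" using cov[OF x] by auto
      then show ?thesis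
        using member_le_sum[of "(j, dyad j x)" C "\<lambda>(j, d). m x * of_bool (dyad j x = d)"] C(1) m0[OF x]
        by auto
    next
      case False
      then have "m x = 0" using m0[OF x] by simp
      then show ?thesis by simp
    qed
  qed
  also have "\<dots> = (\<Sum>(j, d)\<in>C. \<Sum>x\<in>Y. m x * of_bool (dyad j x = d))"
    by (subst sum.swap) (simp add: case_prod_unfold)
  \<comment> \<open>The threshold 4 * b / c0 is doubled by passing to a sparse scale; against the
    mass c0 / 4 this produces the 32.\<close>
  also have "\<dots> \<le> (\<Sum>(j, d)\<in>C. 8 * b / c0 * h j)"
  proof (rule sum_mono, clarify)
    fix j d assume jd: "(j, d) \<in> C"
    show "(\<Sum>x\<in>Y. m x * of_bool (dyad j x = d)) \<le> 8 * b / c0 * h j"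
    proof (cases "\<exists>x\<in>Y. dyad j x = d")
      case True
      then obtain x where x: "x \<in> Y" "dyad j x = d" by auto
      obtain s where s: "s \<le> j" "sparse s" "h s \<le> 2 * h j" using sparse_below by blast
      have "(\<Sum>x\<in>Y. m x * of_bool (dyad j x = d)) \<le> (\<Sum>x\<in>P. m x * of_bool (dyad j x = d))"
        using Y P m0 by (intro sum_mono2) auto
      also have "\<dots> \<le> mass P m s (dyad s x)"
        unfolding mass_def
      proof (intro sum_mono mult_left_mono m0)
        fix y
        show "of_bool (dyad j y = d) \<le> (of_bool (dyad s y = dyad s x) :: real)"
          using dyad_coarser[OF s(1), of y x] x(2) by simp
      qed
      also have "\<dots> \<le> 4 * b / c0 * h s"
      proof -
        have "mass P m s (dyad s x) / h s \<le> maxfun P L m x"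
          using s(1) C(2)[OF jd] by (intro maxfun_ge s(2)) simp
        also have "\<dots> \<le> 4 * b / c0" using x(1) by (simp add: Y_def)
        finally show ?thesis using h_pos[of s] by (simp only: pos_divide_le_eq)
      qed
      also have "\<dots> \<le> 4 * b / c0 * (2 * h j)"
        using s(3) b c0 by (intro mult_left_mono) auto
      finally show ?thesis by simp
    next
      case False
      then have "(\<Sum>x\<in>Y. m x * of_bool (dyad j x = d)) = 0" by (intro sum.neutral) auto
      then show ?thesis using b c0 h_pos[of j] by simp
    qed
  qed
  also have "\<dots> = 8 * b / c0 * (\<Sum>(j, d)\<in>C. h j)"
    by (simp add: case_prod_unfold sum_distrib_left)
  finally show ?thesis using b c0 by (simp add: field_simps power2_eq_square)
qed

text \<open>Only points of \<open>G\<close> hit in each of the first \<open>s\<close> blocks have to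
  be covered; among them are all points where \<open>pdens\<close> is nonzero. The event is decided
  by finitely many indices.\<close>

definition cheap_cover :: "real set \<Rightarrow> (nat \<Rightarrow> nat) \<Rightarrow> nat \<Rightarrow> nat \<Rightarrow> real \<Rightarrow> (nat \<Rightarrow> nat) \<Rightarrow> bool" where
  "cheap_cover G N s L c w \<longleftrightarrow> (\<exists>C. finite C \<and> (\<forall>(j, d)\<in>C. j \<le> L) \<and> (\<Sum>(j, d)\<in>C. h j) < c \<and>
     (\<forall>x\<in>G. (\<forall>i<s. \<exists>n\<in>{N i..<N (Suc i)}. w n = cell n x) \<longrightarrow> (\<exists>(j, d)\<in>C. dyad j x = d)))"

text \<open>More blocks leave fewer points to cover, and a larger \<open>L\<close> admits more
  covers.\<close>

lemma cheap_cover_mono: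
  "cheap_cover G N s L c w \<Longrightarrow> s \<le> s' \<Longrightarrow> L \<le> L' \<Longrightarrow> cheap_cover G N s' L' c w"
  unfolding cheap_cover_def by (elim ex_forward) fastforce

text \<open>Both \<open>N\<close> and \<open>c\<close> precede \<open>s\<close> and
  \<open>L\<close>: a price common to all stages is what survives the passage to the limit
  set.\<close>

lemma blocks_without_cheap_cover:
  assumes G: "G \<subseteq> {0..<1}" and c0: "0 < c0" and \<delta>: "0 < \<delta>"
    and frostman: "\<And>L. \<exists>P m. finite P \<and> P \<subseteq> G \<and> mass_bounded P L m 1 \<and> c0 \<le> (\<Sum>x\<in>P. m x)"
  shows "\<exists>N c. 0 < c \<and> N 0 = 0 \<and> (\<forall>s. N s \<le> N (Suc s)) \<and>
     (\<forall>s L w. Avg 0 (N s) (\<lambda>w. of_bool (cheap_cover G N s L c w)) w \<le> \<delta>)"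
proof -
  \<comment> \<open>\<open>e\<close> bounds the errors of all blocks together. By Markov's
    inequality a loss of half of \<open>c0\<close> then contributes 2 / c0 * e = \<delta> / 2, and
    \<open>b\<close> below is chosen so that a potential above it contributes the other
    half.\<close>
  define e where "e = \<delta> * c0 / 4"
  have e: "0 < e" using c0 \<delta> by (simp add: e_def)
  obtain N D where bs: "block_seq N D (\<lambda>s. e * (1 / 2) ^ Suc s)"
    using block_seq_exists[of "\<lambda>s. e * (1 / 2) ^ Suc s"] e by auto
  have sum_e: "(\<Sum>i<s. e * (1 / 2) ^ Suc i) \<le> e" for s
  proof -
    have "(\<Sum>i<s. e * (1 / 2) ^ Suc i) = e * (1 - (1 / 2) ^ s)"
      by (induction s) (auto simp: algebra_simps)
    also have "\<dots> \<le> e * 1" using e by (intro mult_left_mono) auto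
    finally show ?thesis by simp
  qed
  define b where "b = 2 * ((\<psi> 0)\<^sup>2 * h 0 + e) / \<delta>"
  have b: "0 < b" using \<psi>_pos[of 0] h_pos[of 0] e \<delta> by (simp add: b_def add_pos_pos)
  define c where "c = c0\<^sup>2 / (32 * b)"
  have c: "0 < c" using c0 b by (simp add: c_def)
  have "Avg 0 (N s) (\<lambda>w. of_bool (cheap_cover G N s L c w)) w \<le> \<delta>" for s L w
  proof -
    \<comment> \<open>The point masses have to resolve the cover as well as every cell used in the
      first \<open>s\<close> blocks.\<close>
    define L' where "L' = Max (insert L (level ` {..<N s}))"
    have L': "L \<le> L'" "\<forall>n<N s. level n \<le> L'" by (auto simp: L'_def intro!: Max_ge)
    obtain P m where P: "finite P" "P \<subseteq> G" and m: "mass_bounded P L' m 1" and T: "c0 \<le> (\<Sum>x\<in>P. m x)"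
      using frostman by blast
    have P1: "P \<subseteq> {0..<1}" using P G by auto
    have m0: "\<And>x. x \<in> P \<Longrightarrow> 0 \<le> m x" using m by (simp add: mass_bounded_def)
    let ?m = "\<lambda>w x. m x * pdens N s w x"
    let ?dev = "\<lambda>w. \<bar>(\<Sum>x\<in>P. ?m w x) - (\<Sum>x\<in>P. m x)\<bar>"
    \<comment> \<open>Markov's inequality before averaging: if the right side is below 1, then mass
      at least c0 / 2 and potential at most \<open>b\<close> rule out a cover cheaper than
      \<open>c\<close>.\<close>
    have "of_bool (cheap_cover G N s L c w) \<le> 2 / c0 * ?dev w + 1 / b * potential P L' (?m w)" for w
    proof -
      have mw: "\<And>x. x \<in> P \<Longrightarrow> 0 \<le> ?m w x" using mass_bounded_pdens[OF bs m, of s w] by (simp add: mass_bounded_def)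
      have pot0: "0 \<le> potential P L' (?m w)"
        unfolding potential_def using mw maxfun_nonneg[of P "?m w"] by (intro sum_nonneg) auto
      have expensive: False if "cheap_cover G N s L c w" and less: "2 / c0 * ?dev w + 1 / b * potential P L' (?m w) < 1"
      proof -
        from pot0 b have "0 \<le> 1 / b * potential P L' (?m w)" by simp
        moreover have "0 \<le> 2 / c0 * ?dev w" using c0 by simp
        ultimately have "2 / c0 * ?dev w < 1" "1 / b * potential P L' (?m w) < 1" using less by linarith+
        then have "?dev w < c0 / 2" "potential P L' (?m w) \<le> b" using c0 b by (simp_all add: field_simps)
        then have tw: "c0 / 2 \<le> (\<Sum>x\<in>P. ?m w x)" and pw: "potential P L' (?m w) \<le> b" using T by linarith+
        have "cheap_cover G N s L' c w" by (rule cheap_cover_mono[OF that(1) order.refl L'(1)])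
        then obtain C where C: "finite C" "\<forall>(j, d)\<in>C. j \<le> L'" "(\<Sum>(j, d)\<in>C. h j) < c"
          "\<forall>x\<in>G. (\<forall>i<s. \<exists>n\<in>{N i..<N (Suc i)}. w n = cell n x) \<longrightarrow> (\<exists>(j, d)\<in>C. dyad j x = d)"
          unfolding cheap_cover_def by blast
        have "c \<le> (\<Sum>(j, d)\<in>C. h j)"
          unfolding c_def
        proof (rule cover_cost_ge[OF P(1) mw c0 b tw pw C(1)])
          show "\<And>j d. (j, d) \<in> C \<Longrightarrow> j \<le> L'" using C(2) by auto
          fix x assume x: "x \<in> P" "0 < ?m w x"
          then have pd: "pdens N s w x \<noteq> 0" by auto
          have "\<exists>n\<in>{N i..<N (Suc i)}. w n = cell n x" if "i < s" for i
          proof (rule ccontr)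
            assume "\<not> (\<exists>n\<in>{N i..<N (Suc i)}. w n = cell n x)"
            moreover have "N i \<le> N (Suc i)" using bs by (simp add: block_seq_def)
            ultimately have "dens (N i) (N (Suc i) - N i) w x = 0"
              unfolding dens_def by (intro sum.neutral) auto
            then have "pdens N s w x = 0" unfolding pdens_def using that by (auto intro: prod_zero)
            then show False using pd by simp
          qed
          then show "\<exists>(j, d)\<in>C. dyad j x = d" using C(4) x(1) P(2) by blast
        qed
        then show False using C(3) by simp
      qed
      have "0 \<le> 2 / c0 * ?dev w + 1 / b * potential P L' (?m w)" using pot0 b c0 by simp
      then show ?thesis
      proof (cases "cheap_cover G N s L c w")
        case True
        then have "1 \<le> 2 / c0 * ?dev w + 1 / b * potential P L' (?m w)"
          using expensive[OF True] by (meson not_less)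
        then show ?thesis using True by simp
      qed simp
    qed
    then have "Avg 0 (N s) (\<lambda>w. of_bool (cheap_cover G N s L c w)) w
       \<le> Avg 0 (N s) (\<lambda>w. 2 / c0 * ?dev w + 1 / b * potential P L' (?m w)) w" by (rule Avg_mono)
    also have "\<dots> = 2 / c0 * Avg 0 (N s) ?dev w + 1 / b * Avg 0 (N s) (\<lambda>w. potential P L' (?m w)) w"
      by (simp only: Avg_plus Avg_cmult)
    also have "Avg 0 (N s) ?dev w \<le> e"
      using conjunct2[OF Avg_iterate[OF bs P(1) P1 m L'(2), of w]] sum_e[of s] by linarith
    also have "Avg 0 (N s) (\<lambda>w. potential P L' (?m w)) w \<le> (\<psi> 0)\<^sup>2 * h 0 + e"
    proof -
      have "potential P L' m \<le> (\<Sum>x\<in>P. m x * \<psi> 0)" unfolding potential_def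
      proof (intro sum_mono mult_left_mono m0 maxfun_le)
        fix x j assume "j \<le> L'"
        then have "mass P m j (dyad j x) \<le> \<psi> j * h j" using m by (simp add: mass_bounded_def)
        also have "\<dots> \<le> \<psi> 0 * h j" using \<psi>_antimono[of 0 j] h_pos[of j] by simp
        finally show "mass P m j (dyad j x) / h j \<le> \<psi> 0" using h_pos[of j] by (simp add: field_simps)
      qed
      also have "\<dots> = \<psi> 0 * (\<Sum>x\<in>P. m x)" by (simp add: sum_distrib_left mult_ac)
      also have "\<dots> \<le> \<psi> 0 * (\<psi> 0 * h 0)"
        using mass_bounded_total[OF m P1] \<psi>_pos[of 0] by (intro mult_left_mono) auto
      finally have "potential P L' m \<le> (\<psi> 0)\<^sup>2 * h 0" by (simp add: power2_eq_square)
      then show ?thesis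
        using conjunct1[OF Avg_iterate[OF bs P(1) P1 m L'(2), of w]] sum_e[of s] by linarith
    qed
    finally have "Avg 0 (N s) (\<lambda>w. of_bool (cheap_cover G N s L c w)) w
       \<le> 2 / c0 * e + 1 / b * ((\<psi> 0)\<^sup>2 * h 0 + e)"
      using c0 b by (simp add: divide_right_mono)
    also have "2 / c0 * e = \<delta> / 2" using c0 by (simp add: e_def)
    also have "1 / b * ((\<psi> 0)\<^sup>2 * h 0 + e) = \<delta> / 2"
    proof -
      have "0 < (\<psi> 0)\<^sup>2 * h 0 + e" using \<psi>_pos[of 0] h_pos[of 0] e by (simp add: add_pos_pos)
      moreover have "1 / (2 * X / \<delta>) * X = \<delta> / 2" if "0 < X" for X :: real
        using \<delta> that by simp
      ultimately show ?thesis unfolding b_def by blast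
    qed
    finally show ?thesis by simp
  qed
  then show ?thesis using c bs by (intro exI[of _ N] exI[of _ c]) (auto simp: block_seq_def)
qed

end

section \<open>Frostman measures on the dyadic tree\<close>

definition flow_cut ::
  "(nat \<Rightarrow> real) \<Rightarrow> real set \<Rightarrow> nat \<Rightarrow> nat \<Rightarrow> int \<Rightarrow> real set \<Rightarrow> (real \<Rightarrow> real) \<Rightarrow> (nat \<times> int) set \<Rightarrow> bool" where
  "flow_cut g G L i d P m C \<longleftrightarrow> finite P \<and> P \<subseteq> {x \<in> G. dyad i x = d} \<and> (\<forall>x\<in>P. 0 \<le> m x) \<and>
    (\<forall>j d'. i \<le> j \<longrightarrow> j \<le> L \<longrightarrow> mass P m j d' \<le> g j) \<and> finite C \<and>
    (\<forall>x\<in>G. dyad i x = d \<longrightarrow> (\<exists>(j, e)\<in>C. dyad j x = e)) \<and> (\<Sum>(j, e)\<in>C. g j) \<le> (\<Sum>x\<in>P. m x)"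

text \<open>The masses \<open>m\<close> form a flow through the dyadic tree of depth \<open>L\<close> with capacities \<open>g\<close>, and \<open>C\<close>
  is a cut whose capacity does not exceed the value of the flow.\<close>

lemma flow_cut_exists:
  assumes g: "\<And>j. 0 \<le> g j" and "i \<le> L"
  shows "\<exists>P m C. flow_cut g G L i d P m C"
  using assms(2)
proof (induction i arbitrary: d rule: inc_induct)
  case base
  show ?case
  proof (cases "\<exists>x\<in>G. dyad L x = d")
    case True
    then obtain x where x: "x \<in> G" "dyad L x = d" by auto
    have "mass {x} (\<lambda>_. g L) L d' \<le> g L" for d'
      using mass_le_total[of "{x}" "\<lambda>_. g L" L d'] g by simp
    then have "flow_cut g G L L d {x} (\<lambda>_. g L) {(L, d)}"
      using x g unfolding flow_cut_def by (auto dest: order.antisym)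
    then show ?thesis by blast
  next
    case False
    then have "flow_cut g G L L d {} (\<lambda>_. 0) {}" using g by (simp add: flow_cut_def mass_def)
    then show ?thesis by blast
  qed
next
  case (step i)
  obtain P1 m1 C1 where "flow_cut g G L (Suc i) (2 * d) P1 m1 C1" using step.IH by blast
  then have 1: "finite P1" "P1 \<subseteq> {x \<in> G. dyad (Suc i) x = 2 * d}"
    "\<forall>x\<in>P1. 0 \<le> m1 x" "\<forall>j d'. Suc i \<le> j \<longrightarrow> j \<le> L \<longrightarrow> mass P1 m1 j d' \<le> g j" "finite C1"
    "\<forall>x\<in>G. dyad (Suc i) x = 2 * d \<longrightarrow> (\<exists>(j, e)\<in>C1. dyad j x = e)"
    "(\<Sum>(j, e)\<in>C1. g j) \<le> (\<Sum>x\<in>P1. m1 x)" unfolding flow_cut_def by - (elim conjE, assumption)+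
  obtain P2 m2 C2 where "flow_cut g G L (Suc i) (2 * d + 1) P2 m2 C2" using step.IH by blast
  then have 2: "finite P2" "P2 \<subseteq> {x \<in> G. dyad (Suc i) x = 2 * d + 1}"
    "\<forall>x\<in>P2. 0 \<le> m2 x" "\<forall>j d'. Suc i \<le> j \<longrightarrow> j \<le> L \<longrightarrow> mass P2 m2 j d' \<le> g j" "finite C2"
    "\<forall>x\<in>G. dyad (Suc i) x = 2 * d + 1 \<longrightarrow> (\<exists>(j, e)\<in>C2. dyad j x = e)"
    "(\<Sum>(j, e)\<in>C2. g j) \<le> (\<Sum>x\<in>P2. m2 x)" unfolding flow_cut_def by - (elim conjE, assumption)+
  define P where "P = P1 \<union> P2"
  define m where "m x = (if x \<in> P1 then m1 x else m2 x)" for x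
  have disj: "P1 \<inter> P2 = {}" using 1(2) 2(2) by (fastforce simp: subset_iff)
  have P: "finite P" "P \<subseteq> {x \<in> G. dyad i x = d}"
    using 1(1,2) 2(1,2) dyad_div[of i "Suc i"] by (auto simp: P_def)
  have m0: "\<And>x. x \<in> P \<Longrightarrow> 0 \<le> m x" using 1(3) 2(3) by (auto simp: P_def m_def)
  have split: "(\<Sum>x\<in>P. m x * u x) = (\<Sum>x\<in>P1. m1 x * u x) + (\<Sum>x\<in>P2. m2 x * u x)" for u
    unfolding P_def using 1(1) 2(1) disj
    by (subst sum.union_disjoint) (auto intro!: arg_cong2[where f="(+)"] sum.cong simp: m_def)
  have mass: "mass P m j d' \<le> g j" if j: "Suc i \<le> j" "j \<le> L" for j d'
  proof -
    have eq: "mass P m j d' = mass P1 m1 j d' + mass P2 m2 j d'"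
      unfolding mass_def by (rule split)
    have le: "mass P1 m1 j d' \<le> g j" "mass P2 m2 j d' \<le> g j" using 1(4) 2(4) j by auto
    show ?thesis
    proof (cases "\<exists>x\<in>P1. dyad j x = d'")
      case True
      then obtain x where x: "x \<in> P1" "dyad j x = d'" by auto
      have "dyad j y \<noteq> d'" if "y \<in> P2" for y
        using dyad_coarser[OF j(1), of x y] x that 1(2) 2(2) by (auto simp: subset_iff)
      then have "mass P2 m2 j d' = 0" unfolding mass_def by (intro sum.neutral) auto
      then show ?thesis using eq le by simp
    next
      case False
      then have "mass P1 m1 j d' = 0" unfolding mass_def by (intro sum.neutral) auto
      then show ?thesis using eq le by simp
    qed
  qed
  define t where "t = (\<Sum>x\<in>P. m x)"
  have t: "t = (\<Sum>x\<in>P1. m1 x) + (\<Sum>x\<in>P2. m2 x)" using split[of "\<lambda>_. 1"] by (simp add: t_def)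
  have le_t: "mass P m j d' \<le> t" for j d' unfolding t_def by (intro mass_le_total m0)
  \<comment> \<open>Max-flow min-cut on a tree: if the flows of the two subtrees fit through the
    node, flows and cuts are united; otherwise the flow is scaled down to the capacity
    \<open>g i\<close> and the node alone becomes the cut.\<close>
  show ?case
  proof (cases "t \<le> g i")
    case True
    have "mass P m j d' \<le> g j" if "i \<le> j" "j \<le> L" for j d'
      using mass[of j d'] le_t[of j d'] True that by (cases "i = j") auto
    moreover have "\<exists>(j, e)\<in>C1 \<union> C2. dyad j x = e" if "x \<in> G" "dyad i x = d" for x
    proof -
      have "dyad (Suc i) x div 2 = d" using that dyad_div[of i "Suc i" x] by simp
      then have "dyad (Suc i) x = 2 * d \<or> dyad (Suc i) x = 2 * d + 1" by linarith
      then show ?thesis using 1(6) 2(6) that(1) by blast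
    qed
    moreover have "(\<Sum>(j, e)\<in>C1 \<union> C2. g j) \<le> (\<Sum>x\<in>P. m x)"
    proof -
      have "0 \<le> (\<Sum>(j, e)\<in>C1 \<inter> C2. g j)" using g by (intro sum_nonneg) auto
      then have "(\<Sum>(j, e)\<in>C1 \<union> C2. g j) \<le> (\<Sum>(j, e)\<in>C1. g j) + (\<Sum>(j, e)\<in>C2. g j)"
        using 1(5) 2(5) by (simp add: sum_Un)
      then show ?thesis using 1(7) 2(7) t by (simp add: t_def)
    qed
    ultimately have "flow_cut g G L i d P m (C1 \<union> C2)"
      using P m0 1(5) 2(5) unfolding flow_cut_def by blast
    then show ?thesis by blast
  next
    case False
    then have t0: "0 < t" and gt: "g i / t \<le> 1" using g[of i] by (auto simp: field_simps)
    define a where "a = g i / t"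
    have a: "0 \<le> a" "a \<le> 1" using t0 gt g[of i] by (auto simp: a_def)
    have at: "a * t = g i" using t0 by (simp add: a_def)
    have scale: "mass P (\<lambda>x. a * m x) j d' = a * mass P m j d'" for j d'
      by (simp only: mass_def sum_distrib_left mult.assoc)
    have "mass P (\<lambda>x. a * m x) j d' \<le> g j" if "i \<le> j" "j \<le> L" for j d'
    proof (cases "i = j")
      case True
      have "a * mass P m j d' \<le> a * t" by (intro mult_left_mono le_t a)
      then show ?thesis using True at by (simp only: scale)
    next
      case False
      then have "a * mass P m j d' \<le> 1 * g j"
        using mass[of j d'] that a mass_nonneg[of P m j d', OF m0] by (intro mult_mono) auto
      then show ?thesis by (simp add: scale)
    qed
    moreover have "(\<Sum>x\<in>P. a * m x) = g i"
      using t0 unfolding sum_distrib_left[symmetric] t_def[symmetric] by (simp add: a_def)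
    ultimately have "flow_cut g G L i d P (\<lambda>x. a * m x) {(i, d)}"
      using P m0 a by (simp add: flow_cut_def)
    then show ?thesis by blast
  qed
qed

section \<open>The circle and dyadic content\<close>

lemma tdist_le_shift: "tdist x y \<le> \<bar>x - y - of_int k\<bar>"
proof -
  have "frac (x - y) = frac (x - y - of_int k)" by (simp add: frac_def)
  moreover have "min (frac z) (1 - frac z) \<le> \<bar>z\<bar>" for z :: real
  proof (cases "0 \<le> z")
    case True
    then have "0 \<le> \<lfloor>z\<rfloor>" by simp
    then have "frac z \<le> \<bar>z\<bar>" using True by (simp add: frac_def)
    then show ?thesis by (simp add: min_le_iff_disj)
  next
    case False
    then have "\<lfloor>z\<rfloor> \<le> -1" by linarith
    then have "1 - frac z \<le> \<bar>z\<bar>" using False unfolding frac_def by linarith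
    then show ?thesis by (simp add: min_le_iff_disj)
  qed
  ultimately show ?thesis unfolding tdist_def by simp
qed

lemma tdist_le: "tdist x y \<le> \<bar>x - y\<bar>"
  using tdist_le_shift[of x y 0] by simp

text \<open>The two explicit candidates for \<open>k\<close> later limit the number of translates
  needed to lift a covering set to the line.\<close>

lemma tdist_attained: "\<exists>k. tdist x y = \<bar>x - y - of_int k\<bar> \<and> k \<in> {\<lfloor>x - y\<rfloor>, \<lfloor>x - y\<rfloor> + 1}"
proof (cases "frac (x - y) \<le> 1 - frac (x - y)")
  case True
  then show ?thesis
    by (intro exI[of _ "\<lfloor>x - y\<rfloor>"]) (auto simp: tdist_def frac_def)
next
  case False
  then show ?thesis
    using frac_lt_1[of "x - y"]
    by (intro exI[of _ "\<lfloor>x - y\<rfloor> + 1"]) (auto simp: tdist_def frac_def)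
qed

lemma tdist_nonneg: "0 \<le> tdist x y"
  using tdist_attained[of x y] by auto

lemma tdist_le_1: "tdist x y \<le> 1"
  using frac_lt_1[of "x - y"] by (simp add: tdist_def min_le_iff_disj)

lemma tdist_frac: "tdist (frac x) y = tdist x y"
proof -
  have "frac x - y = x - y - of_int \<lfloor>x\<rfloor>" by (simp add: frac_def)
  moreover have "frac (x - y - of_int k) = frac (x - y)" for k by (simp add: frac_def)
  ultimately have "frac (frac x - y) = frac (x - y)" by metis
  then show ?thesis by (simp add: tdist_def)
qed

lemma tdist_commute: "tdist x y = tdist y x"
proof -
  have "tdist x y \<le> tdist y x" for x y
  proof -
    obtain k where "tdist y x = \<bar>y - x - of_int k\<bar>" using tdist_attained by blast
    then show ?thesis using tdist_le_shift[of x y "- k"] by simp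
  qed
  then show ?thesis by (meson order.antisym)
qed

lemma tdist_triangle: "tdist x z \<le> tdist x y + tdist y z"
proof -
  obtain k where k: "tdist x y = \<bar>x - y - of_int k\<bar>" using tdist_attained by blast
  obtain l where l: "tdist y z = \<bar>y - z - of_int l\<bar>" using tdist_attained by blast
  show ?thesis using tdist_le_shift[of x z "k + l"] k l by simp
qed

lemma Metric_space_torus: "Metric_space torus tdist"
proof
  fix x y z assume xy: "x \<in> torus" "y \<in> torus"
  have "x = y" if "tdist x y = 0"
  proof -
    obtain k where "tdist x y = \<bar>x - y - of_int k\<bar>" using tdist_attained by blast
    then have k: "x - y = of_int k" using that by simp
    then have "-1 < k" "k < 1" using xy by (auto simp: torus_def)
    then show ?thesis using k by simp
  qed
  then show "tdist x y = 0 \<longleftrightarrow> x = y" by (auto simp: tdist_def)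
qed (rule tdist_nonneg tdist_commute tdist_triangle)+

text \<open>The representatives [0,1) are not compact in the real line. Adding the endpoint 1 and
  pulling back along \<open>frac\<close>, which does not increase distances to the circle, gives a
  compact set of reals in which 0 and 1 stand for the same point.\<close>

lemma compact_lift:
  assumes "compactin ttop G"
  shows "compact {x \<in> {0..1}. frac x \<in> G}"
proof -
  interpret T: Metric_space torus tdist by (rule Metric_space_torus)
  have "closedin T.mtopology G"
    using assms compactin_imp_closedin[OF T.Hausdorff_space_mtopology] by (simp add: ttop_def)
  then have op: "openin T.mtopology (torus - G)" by (simp add: closedin_def)
  have "open {x. frac x \<notin> G}"
    unfolding open_dist
  proof safe
    fix x :: real assume "frac x \<notin> G"
    moreover have fr: "frac z \<in> torus" for z :: real by (simp add: torus_def frac_lt_1)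
    ultimately have "frac x \<in> torus - G" by auto
    then obtain e where e: "e > 0" "T.mball (frac x) e \<subseteq> torus - G"
      using op unfolding T.openin_mtopology by blast
    have "frac y \<notin> G" if "dist y x < e" for y
    proof -
      have "tdist (frac x) (frac y) \<le> \<bar>x - y\<bar>"
        using tdist_le[of x y] by (metis tdist_commute tdist_frac)
      then have "frac y \<in> T.mball (frac x) e" using that fr by (auto simp: dist_real_def)
      then show ?thesis using e(2) by auto
    qed
    then show "\<exists>e>0. \<forall>y. dist y x < e \<longrightarrow> y \<in> {x. frac x \<notin> G}" using e(1) by blast
  qed
  then have "closed {x. frac x \<in> G}" by (simp add: closed_def Collect_neg_eq)
  then have "compact ({0..1} \<inter> {x. frac x \<in> G})" by (intro compact_Int_closed) auto
  then show ?thesis by (simp add: Int_def)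
qed

lemma tdist_le_tdiam:
  assumes "x \<in> U" "y \<in> U"
  shows "tdist x y \<le> tdiam U"
proof -
  have bdd: "bdd_above (tdist x ` U)" for x using tdist_le_1 by (intro bdd_aboveI2)
  have "bdd_above ((\<lambda>x. SUP y\<in>U. tdist x y) ` U)"
  proof (rule bdd_aboveI2)
    show "(SUP y\<in>U. tdist x y) \<le> 1" for x
      using assms(1) by (intro cSUP_least tdist_le_1) auto
  qed
  from cSUP_upper[OF assms(1) this] cSUP_upper[OF assms(2) bdd, of x]
  show ?thesis using assms by (auto simp: tdiam_def)
qed

lemma tdiam_nonneg: "0 \<le> tdiam U"
proof (cases "U = {}")
  case False
  then obtain x where "x \<in> U" by auto
  from tdist_le_tdiam[OF this this] tdist_nonneg[of x x] show ?thesis by linarith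
qed (simp add: tdiam_def)

lemma tdiam_le:
  assumes "0 \<le> b" "\<And>x y. x \<in> U \<Longrightarrow> y \<in> U \<Longrightarrow> tdist x y \<le> b"
  shows "tdiam U \<le> b"
  using assms by (auto simp: tdiam_def intro!: cSUP_least)

lemma tdiam_less_1: "tdiam U < 1"
proof -
  have "tdist x y \<le> 1 / 2" for x y by (cases "frac (x - y) \<le> 1 / 2") (auto simp: tdist_def min_le_iff_disj)
  then have "tdiam U \<le> 1 / 2" by (intro tdiam_le) auto
  then show ?thesis by simp
qed

lemma gauge_mono: "gauge_fun g \<Longrightarrow> 0 \<le> x \<Longrightarrow> x \<le> y \<Longrightarrow> g x \<le> g y"
  by (auto simp: gauge_fun_def mono_on_def)

lemma gauge_pos: "gauge_fun g \<Longrightarrow> 0 < x \<Longrightarrow> 0 < g x"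
  using gauge_mono[of g 0 x] by (force simp: gauge_fun_def less_le)

lemma gauge_nonneg: "gauge_fun g \<Longrightarrow> 0 \<le> x \<Longrightarrow> 0 \<le> g x"
  using gauge_pos[of g x] by (cases "x = 0") (auto simp: gauge_fun_def)

text \<open>Covers by intervals of length at most some \<delta> are controlled by the pre-measure at
  \<delta>; a cover with a longer interval costs at least \<open>g \<delta>\<close> by
  monotonicity.\<close>

lemma dyadic_content_pos:
  assumes g: "gauge_fun g" and G: "G \<subseteq> torus" and pos: "hausdorff_measure g G > 0"
  shows "\<exists>c>0. \<forall>C. finite C \<longrightarrow> (\<forall>x\<in>G. \<exists>(j, d)\<in>C. dyad j x = d) \<longrightarrow> c \<le> (\<Sum>(j, d)\<in>C. g (1 / 2 ^ j))"
proof -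
  obtain \<delta> where \<delta>: "0 < \<delta>" "0 < hausdorff_pre g \<delta> G"
    using pos by (auto simp: hausdorff_measure_def less_SUP_iff)
  obtain c where c: "0 < c" "ennreal c \<le> hausdorff_pre g \<delta> G"
  proof (cases "hausdorff_pre g \<delta> G")
    case (real x)
    then show ?thesis using \<delta>(2) that[of x] by auto
  next
    case top
    then show ?thesis using that[of 1] by auto
  qed
  have "min c (g \<delta>) \<le> (\<Sum>(j, d)\<in>C. g (1 / 2 ^ j))"
    if C: "finite C" and cov: "\<forall>x\<in>G. \<exists>(j, d)\<in>C. dyad j x = d" for C
  proof (cases "\<exists>(j, d)\<in>C. \<delta> < 1 / 2 ^ j")
    case True
    then obtain j d where jd: "(j, d) \<in> C" "\<delta> < 1 / 2 ^ j" by auto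
    have "g \<delta> \<le> g (1 / 2 ^ j)" using gauge_mono[OF g] \<delta>(1) jd(2) by simp
    also have "\<dots> \<le> (\<Sum>(j, d)\<in>C. g (1 / 2 ^ j))"
    proof -
      have "0 \<le> (case p of (j, d) \<Rightarrow> g (1 / 2 ^ j))" for p
        by (cases p) (simp add: gauge_nonneg[OF g])
      then have "(\<lambda>(j, d). g (1 / 2 ^ j)) (j, d) \<le> (\<Sum>(j, d)\<in>C. g (1 / 2 ^ j))"
        by (intro member_le_sum jd(1) C)
      then show ?thesis by simp
    qed
    finally show ?thesis by simp
  next
    case False
    obtain xs where xs: "set xs = C" "distinct xs" using finite_distinct_list[OF C] by blast
    define J where "J p = {x \<in> torus. dyad (fst p) x = snd p}" for p
    have Jd: "tdiam (J p) \<le> 1 / 2 ^ fst p" for p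
    proof (rule tdiam_le)
      fix x y assume "x \<in> J p" "y \<in> J p"
      then have "\<bar>x - y\<bar> * 2 ^ fst p < 1" by (intro dyad_dist) (auto simp: J_def)
      then have "\<bar>x - y\<bar> \<le> 1 / 2 ^ fst p" by (simp add: field_simps)
      then show "tdist x y \<le> 1 / 2 ^ fst p" using tdist_le[of x y] by linarith
    qed simp
    define U where "U i = (if i < length xs then J (xs ! i) else {})" for i
    have "ennreal c \<le> (\<Sum>i. ennreal (g (tdiam (U i))))"
    proof (rule order_trans[OF c(2)], unfold hausdorff_pre_def, rule INF_lower, safe)
      fix i
      show "x \<in> torus" if "x \<in> U i" for x using that by (auto simp: U_def J_def split: if_splits)
      show "tdiam (U i) \<le> \<delta>"
      proof (cases "i < length xs")
        case True
        then have "xs ! i \<in> C" using xs by auto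
        then have "1 / 2 ^ fst (xs ! i) \<le> \<delta>" using False by (auto simp: not_less)
        then show ?thesis using Jd[of "xs ! i"] True by (simp add: U_def)
      qed (use \<delta> in \<open>simp add: U_def tdiam_def\<close>)
    next
      fix x assume x: "x \<in> G"
      then obtain p where p: "p \<in> C" "dyad (fst p) x = snd p" using cov by force
      then obtain i where "i < length xs" "xs ! i = p" using xs by (metis in_set_conv_nth)
      then show "x \<in> (\<Union>i. U i)" using p x G by (auto simp: U_def J_def intro!: exI[of _ i])
    qed
    also have "\<dots> = (\<Sum>i<length xs. ennreal (g (tdiam (U i))))"
      by (rule suminf_finite) (use g in \<open>auto simp: U_def tdiam_def gauge_fun_def\<close>)
    also have "\<dots> \<le> (\<Sum>i<length xs. ennreal (g (1 / 2 ^ fst (xs ! i))))"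
      by (intro sum_mono ennreal_leI gauge_mono[OF g]) (auto simp: U_def tdiam_nonneg Jd)
    also have "\<dots> = ennreal (\<Sum>i<length xs. g (1 / 2 ^ fst (xs ! i)))"
      by (intro sum_ennreal gauge_nonneg[OF g]) auto
    also have "(\<Sum>i<length xs. g (1 / 2 ^ fst (xs ! i))) = (\<Sum>(j, d)\<in>C. g (1 / 2 ^ j))"
      using xs by (simp add: sum.distinct_set_conv_list sum_list_sum_nth atLeast0LessThan case_prod_unfold flip: xs(1))
    finally have "c \<le> (\<Sum>(j, d)\<in>C. g (1 / 2 ^ j))"
      by (subst (asm) ennreal_le_iff) (auto intro!: sum_nonneg gauge_nonneg[OF g])
    then show ?thesis by simp
  qed
  moreover have "0 < min c (g \<delta>)" using c(1) gauge_pos[OF g \<delta>(1)] by simp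
  ultimately show ?thesis by blast
qed

lemma dyad_near:
  assumes "\<bar>x - y\<bar> < d" "d < 2 / 2 ^ j"
  shows "dyad j x \<in> {dyad j y - 2..dyad j y + 2}"
proof -
  have "\<bar>x - y\<bar> < 2 / 2 ^ j" using assms by linarith
  then have "\<bar>x - y\<bar> * 2 ^ j < 2" by (simp add: field_simps)
  then have "\<bar>2 ^ j * x - 2 ^ j * y\<bar> < 2" by (simp add: abs_diff_scale)
  then show ?thesis unfolding dyad_def atLeastAtMost_iff by linarith
qed

lemma dyadic_scale:
  fixes d :: real
  assumes "0 < d" "d < 1"
  shows "\<exists>j. 1 / 2 ^ j \<le> d \<and> d < 2 / 2 ^ j"
proof -
  obtain n where n: "(1 / 2) ^ n < d" using real_arch_pow_inv[of d "1/2"] assms by auto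
  define j where "j = (LEAST j. 1 / 2 ^ j \<le> d)"
  have "1 / 2 ^ n \<le> d" using n by (simp add: power_one_over)
  then have j: "1 / 2 ^ j \<le> d" unfolding j_def by (rule LeastI)
  then have "j \<noteq> 0" using assms by (intro notI) simp
  then have "\<not> 1 / 2 ^ (j - 1) \<le> d" unfolding j_def by (intro not_less_Least) simp
  then have "d < 2 / 2 ^ j" using \<open>j \<noteq> 0\<close> by (cases j) auto
  then show ?thesis using j by blast
qed

text \<open>Right-continuity lets covering sets, even those of diameter zero, be replaced by open
  ones at an arbitrarily small extra cost.\<close>

lemma gauge_right_enlarge:
  assumes "gauge_fun h" "0 \<le> t" "t < 1" "0 < \<epsilon>"
  shows "\<exists>d. t < d \<and> d < 1 \<and> h d \<le> h t + \<epsilon>"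
proof -
  have "(h \<longlongrightarrow> h t) (at_right t)" using assms by (simp add: gauge_fun_def continuous_within)
  then have "eventually (\<lambda>x. h x < h t + \<epsilon>) (at_right t)"
    using assms(4) by (intro order_tendstoD(2)) auto
  then obtain b where b: "t < b" "\<And>y. t < y \<Longrightarrow> y < b \<Longrightarrow> h y < h t + \<epsilon>"
    by (auto simp: eventually_at_right_field)
  obtain d where "t < d" "d < min b 1" using dense[of t "min b 1"] b(1) assms(3) by auto
  then show ?thesis using b(2)[of d] by (intro exI[of _ d]) auto
qed

text \<open>Turns an open cover of the limit set into a cover of some finite stage.\<close>

lemma compact_nested_subset:
  fixes F :: "nat \<Rightarrow> 'a :: heine_borel set"
  assumes "\<And>s. compact (F s)" "\<And>s s'. s \<le> s' \<Longrightarrow> F s' \<subseteq> F s" "open S" "(\<Inter>s. F s) \<subseteq> S"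
  shows "\<exists>s. F s \<subseteq> S"
proof (rule ccontr)
  assume "\<nexists>s. F s \<subseteq> S"
  then have "F s - S \<noteq> {}" for s by blast
  moreover have "compact (F s - S)" for s
    using assms(1,3) by (rule compact_diff)
  moreover have "F s' - S \<subseteq> F s - S" if "s \<le> s'" for s s'
    using assms(2)[OF that] by auto
  ultimately have "(\<Inter>s. F s - S) \<noteq> {}" by (intro compact_nest)
  then show False using assms(4) by auto
qed

text \<open>A set of diameter less than \<open>d\<close> lifts to at most four intervals of length \<open>2 d\<close> in the
  real line, each meeting at most five dyadic intervals whose length is the power of two just
  below \<open>d\<close>; rounding down avoids any doubling assumption on the gauge.\<close>

lemma hausdorff_measure_pos:
  fixes F :: "nat \<Rightarrow> real set"
  assumes h: "gauge_fun h" and F: "\<And>s. compact (F s)" "\<And>s s'. s \<le> s' \<Longrightarrow> F s' \<subseteq> F s" "F 0 \<subseteq> {0..1}"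
    and A: "\<And>\<xi>. (\<And>s. \<xi> \<in> F s) \<Longrightarrow> frac \<xi> \<in> A" and c: "0 < c"
    and cost: "\<And>s C. finite C \<Longrightarrow> (\<And>x. x \<in> F s \<Longrightarrow> x < 1 \<Longrightarrow> \<exists>(j, d)\<in>C. dyad j x = d)
      \<Longrightarrow> c \<le> (\<Sum>(j, d)\<in>C. h (1 / 2 ^ j))"
  shows "hausdorff_measure h A > 0"
proof -
  \<comment> \<open>Each covering set yields 4 * 5 = 20 dyadic intervals, and opening up the sets
    costs at most another c / 60 in total, so a cheaper cover would give a dyadic one of cost at
    most 20 * 2 * c / 60 = 2 * c / 3.\<close>
  have "ennreal (c / 60) \<le> hausdorff_pre h 1 A"
    unfolding hausdorff_pre_def
  proof (rule INF_greatest, clarify)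
    fix U :: "nat \<Rightarrow> real set"
    assume U: "\<forall>i. U i \<subseteq> torus \<and> tdiam (U i) \<le> 1" and cov: "A \<subseteq> (\<Union>i. U i)"
    show "ennreal (c / 60) \<le> (\<Sum>i. ennreal (h (tdiam (U i))))"
    proof (rule ccontr)
      assume "\<not> ennreal (c / 60) \<le> (\<Sum>i. ennreal (h (tdiam (U i))))"
      then have small: "(\<Sum>i. ennreal (h (tdiam (U i)))) < ennreal (c / 60)" by simp
      have "\<exists>d. tdiam (U i) < d \<and> d < 1 \<and> h d \<le> h (tdiam (U i)) + c / 60 * (1 / 2) ^ Suc i" for i
        using c by (intro gauge_right_enlarge[OF h tdiam_nonneg tdiam_less_1]) auto
      then obtain d where d: "\<And>i. tdiam (U i) < d i" "\<And>i. d i < 1"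
        "\<And>i. h (d i) \<le> h (tdiam (U i)) + c / 60 * (1 / 2) ^ Suc i" by metis
      have d0: "0 < d i" for i using d(1)[of i] tdiam_nonneg[of "U i"] by linarith
      obtain j where j: "\<And>i. 1 / 2 ^ j i \<le> d i" "\<And>i. d i < 2 / 2 ^ j i"
        using dyadic_scale[OF d0 d(2)] by metis
      have "\<exists>x. U i \<noteq> {} \<longrightarrow> x \<in> U i" for i by blast
      then obtain x where x: "\<And>i. U i \<noteq> {} \<Longrightarrow> x i \<in> U i" by metis
      define O' where "O' i = (\<Union>e\<in>{-1..2::int}. if U i = {} then {} else ball (x i + of_int e) (d i))" for i
      have op: "open (O' i)" for i unfolding O'_def by auto
      have "(\<Inter>s. F s) \<subseteq> (\<Union>i. O' i)"
      proof
        fix \<xi> assume \<xi>: "\<xi> \<in> (\<Inter>s. F s)"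
        then have "frac \<xi> \<in> A" using A by blast
        then obtain i where i: "frac \<xi> \<in> U i" using cov by auto
        then have xi: "x i \<in> U i" using x by blast
        have "tdist \<xi> (x i) < d i"
          using tdist_le_tdiam[OF i xi] d(1)[of i] by (simp add: tdist_frac)
        moreover obtain k where k: "tdist \<xi> (x i) = \<bar>\<xi> - x i - of_int k\<bar>"
          "k \<in> {\<lfloor>\<xi> - x i\<rfloor>, \<lfloor>\<xi> - x i\<rfloor> + 1}" using tdist_attained by blast
        \<comment> \<open>The floor of a difference of a point of [0,1] and one of [0,1) lies
          between -1 and 1, and \<open>k\<close> may be one larger: four translates.\<close>
        moreover have "k \<in> {-1..2}"
        proof -
          have "\<xi> \<in> {0..1}" using \<xi> F(3) by auto
          moreover have "x i \<in> {0..<1}" using xi spec[OF U, of i] by (auto simp: torus_def)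
          ultimately have "-1 \<le> \<lfloor>\<xi> - x i\<rfloor>" "\<lfloor>\<xi> - x i\<rfloor> \<le> 1" by (auto simp: le_floor_iff floor_le_iff)
          then show ?thesis using k(2) by auto
        qed
        ultimately have "\<xi> \<in> ball (x i + of_int k) (d i)" by (simp add: dist_real_def abs_minus_commute algebra_simps)
        moreover have "U i \<noteq> {}" using i by auto
        ultimately have "\<xi> \<in> O' i" using \<open>k \<in> {-1..2}\<close> unfolding O'_def by auto
        then show "\<xi> \<in> (\<Union>i. O' i)" by blast
      qed
      then have "\<exists>s. F s \<subseteq> (\<Union>i. O' i)"
        by (intro compact_nested_subset F(1,2) open_UN ballI op)
      then obtain s where s: "F s \<subseteq> (\<Union>i. O' i)" by blast
      obtain I where I: "finite I" "F s \<subseteq> (\<Union>i\<in>I. O' i)"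
        using compactE_image[OF F(1)[of s], of UNIV O'] op s by auto
      define D where "D = I \<times> {-1..2::int} \<times> {-2..2::int}"
      define f where "f = (\<lambda>(i, e, t). (j i, dyad (j i) (x i + of_int e) + t))"
      have "finite D" using I(1) by (simp add: D_def)
      have "c \<le> (\<Sum>(j, d)\<in>f ` D. h (1 / 2 ^ j))"
      proof (rule cost)
        show "finite (f ` D)" using \<open>finite D\<close> by simp
        fix y assume y: "y \<in> F s" "y < 1"
        then obtain i e where ie: "i \<in> I" "e \<in> {-1..2::int}" "y \<in> ball (x i + of_int e) (d i)"
          using I(2) unfolding O'_def by (auto split: if_splits)
        define t where "t = dyad (j i) y - dyad (j i) (x i + of_int e)"
        have "\<bar>y - (x i + of_int e)\<bar> < d i" using ie(3) by (simp add: dist_real_def abs_minus_commute)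
        then have "t \<in> {-2..2}" using dyad_near[OF _ j(2)[of i]] by (force simp: t_def)
        then have "(i, e, t) \<in> D" using ie by (simp add: D_def)
        then have "f (i, e, t) \<in> f ` D" by (rule imageI)
        moreover have "f (i, e, t) = (j i, dyad (j i) y)" by (simp add: f_def t_def)
        ultimately show "\<exists>(j, d)\<in>f ` D. dyad j y = d" by force
      qed
      also have "\<dots> \<le> (\<Sum>p\<in>D. (\<lambda>(j, d). h (1 / 2 ^ j)) (f p))"
        using sum_image_le[OF \<open>finite D\<close>, of "\<lambda>(j, d). h (1 / 2 ^ j)" f] gauge_nonneg[OF h]
        by (simp add: case_prod_unfold comp_def)
      also have "\<dots> = (\<Sum>i\<in>I. 20 * h (1 / 2 ^ j i))"
      proof -
        have "(\<Sum>p\<in>D. (\<lambda>(j, d). h (1 / 2 ^ j)) (f p))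
            = (\<Sum>i\<in>I. \<Sum>t\<in>{-1..2::int} \<times> {-2..2::int}. h (1 / 2 ^ j i))"
          unfolding sum.cartesian_product D_def f_def by (simp add: case_prod_unfold)
        then show ?thesis by (simp add: card_cartesian_product)
      qed
      also have "\<dots> \<le> (\<Sum>i\<in>I. 20 * (h (tdiam (U i)) + c / 60 * (1 / 2) ^ Suc i))"
        by (intro sum_mono mult_left_mono order_trans[OF _ d(3)] gauge_mono[OF h] j(1)) auto
      also have "\<dots> = 20 * (\<Sum>i\<in>I. h (tdiam (U i))) + 20 * (c / 60) * (\<Sum>i\<in>I. (1 / 2) ^ Suc i)"
        by (simp add: sum.distrib distrib_left sum_distrib_left)
      also have "(\<Sum>i\<in>I. (1 / 2) ^ Suc i) \<le> (\<Sum>i. (1 / 2 :: real) ^ Suc i)"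
        by (intro sum_le_suminf I(1) sums_summable[OF power_half_series]) auto
      also have "(\<Sum>i. (1 / 2 :: real) ^ Suc i) = 1" by (rule sums_unique[OF power_half_series, symmetric])
      also have "(\<Sum>i\<in>I. h (tdiam (U i))) \<le> c / 60"
      proof -
        have "ennreal (\<Sum>i\<in>I. h (tdiam (U i))) = (\<Sum>i\<in>I. ennreal (h (tdiam (U i))))"
          by (intro sum_ennreal[symmetric] gauge_nonneg[OF h] tdiam_nonneg)
        also have "\<dots> \<le> (\<Sum>i. ennreal (h (tdiam (U i))))"
          by (intro sum_le_suminf I(1)) auto
        also have "\<dots> \<le> ennreal (c / 60)" using small by simp
        finally show ?thesis using c by (simp add: ennreal_le_iff)
      qed
      finally have "c \<le> 20 * (c / 60) + 20 * (c / 60) * 1" using c by simp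
      then show False using c by simp
    qed
  qed
  moreover have "hausdorff_pre h 1 A \<le> hausdorff_measure h A"
    unfolding hausdorff_measure_def by (intro SUP_upper) simp
  ultimately have "ennreal (c / 60) \<le> hausdorff_measure h A" by (rule order_trans)
  moreover have "0 < ennreal (c / 60)" using c by simp
  ultimately show ?thesis by (rule less_le_trans[rotated])
qed

section \<open>Gauge functions along dyadic scales\<close>

text \<open>With a = g / h and f = \<phi> at dyadic scales, replacing each a (Suc j) by the smaller
  a n makes the partial sum telescope to a n * (1 / f n - 1 / f J). Summability thus bounds a /
  f.\<close>

lemma gauge_prec_ratio:
  assumes g: "gauge_fun g" and h: "gauge_fun h" and \<phi>: "gauge_fun \<phi>" and prec: "gauge_prec h \<phi> g"
  shows "\<exists>\<psi> K. (\<forall>j. 0 < \<psi> j) \<and> (\<forall>i j. i \<le> j \<longrightarrow> \<psi> j \<le> \<psi> i) \<and> \<psi> \<longlonglongrightarrow> 0 \<and>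
    (\<forall>j. g (1 / 2 ^ j) \<le> \<psi> j * h (1 / 2 ^ j)) \<and> (\<forall>j. \<psi> j \<le> K * \<phi> (1 / 2 ^ j))"
proof -
  define a where "a j = g (1 / 2 ^ j) / h (1 / 2 ^ j)" for j :: nat
  define f where "f j = \<phi> (1 / 2 ^ j)" for j :: nat
  have a0: "0 < a j" for j by (simp add: a_def gauge_pos[OF g] gauge_pos[OF h])
  have f0: "0 < f j" for j by (simp add: f_def gauge_pos[OF \<phi>])
  have f_mono: "f j \<le> f i" if "i \<le> j" for i j
    unfolding f_def using that by (intro gauge_mono[OF \<phi>]) (auto intro: divide_left_mono)
  obtain \<epsilon> where \<epsilon>: "\<epsilon> > 0" "mono_on {0<..\<epsilon>} (\<lambda>x. g x / h x)"
    and lim: "((\<lambda>x. g x / h x) \<longlongrightarrow> 0) (at_right 0)"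
    and summ: "summable (\<lambda>j. g (2 powi (- int (Suc j))) / h (2 powi (- int (Suc j))) *
        (1 / \<phi> (2 powi (- int (Suc j))) - 1 / \<phi> (2 powi (- int j))))"
    using prec by (auto simp: gauge_prec_def)
  have powi: "2 powi (- int j) = (1 / 2 ^ j :: real)" for j
    by (simp add: power_int_minus field_simps)
  have summ: "summable (\<lambda>j. a (Suc j) * (1 / f (Suc j) - 1 / f j))"
    using summ unfolding powi a_def f_def .
  have half: "(\<lambda>j. 1 / 2 ^ j :: real) \<longlonglongrightarrow> 0"
    using LIMSEQ_realpow_zero[of "1 / 2 :: real"] by (simp add: power_one_over)
  then have "filterlim (\<lambda>j. 1 / 2 ^ j :: real) (at_right 0) sequentially"
    by (simp add: filterlim_at)
  then have a_lim: "a \<longlonglongrightarrow> 0" unfolding a_def by (rule filterlim_compose[OF lim])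
  have "eventually (\<lambda>j. 1 / 2 ^ j < \<epsilon>) sequentially" using half \<epsilon>(1) by (rule order_tendstoD(2))
  then obtain J where J: "\<And>j. j \<ge> J \<Longrightarrow> 1 / 2 ^ j < \<epsilon>" by (auto simp: eventually_sequentially)
  have a_mono: "a j \<le> a i" if "J \<le> i" "i \<le> j" for i j
  proof -
    have "(1 :: real) / 2 ^ j \<le> 1 / 2 ^ i"
      using that by (intro divide_left_mono power_increasing) auto
    then show ?thesis
      unfolding a_def using J[of i] J[of j] that by (intro mono_onD[OF \<epsilon>(2)]) auto
  qed
  define S where "S = (\<Sum>j. a (Suc j) * (1 / f (Suc j) - 1 / f j))"
  have tail: "a n * (1 / f n) \<le> S + a J * (1 / f J)" if "J \<le> n" for n
  proof -
    have inc: "0 \<le> 1 / f (Suc j) - 1 / f j" for j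
      using f_mono[of j "Suc j"] f0[of "Suc j"] f0[of j] by (simp add: frac_le)
    have "a n * (1 / f n - 1 / f J) = (\<Sum>j = J..<n. a n * (1 / f (Suc j) - 1 / f j))"
      unfolding sum_distrib_left[symmetric] using that by (subst sum_Suc_diff') auto
    also have "\<dots> \<le> (\<Sum>j = J..<n. a (Suc j) * (1 / f (Suc j) - 1 / f j))"
      by (intro sum_mono mult_right_mono a_mono inc) auto
    also have "\<dots> \<le> S" unfolding S_def
      by (intro sum_le_suminf summ mult_nonneg_nonneg inc less_imp_le[OF a0]) auto
    finally have "a n * (1 / f n) \<le> S + a n * (1 / f J)" by (simp add: right_diff_distrib)
    also have "a n * (1 / f J) \<le> a J * (1 / f J)"
      using f0[of J] by (intro mult_right_mono a_mono that) auto
    finally show ?thesis by simp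
  qed
  define K where "K = S + a J * (1 / f J)"
  have aK: "a n \<le> K * f n" if "J \<le> n" for n
    using tail[OF that] f0[of n] by (simp add: K_def field_simps)
  \<comment> \<open>Monotonicity of g / h is available only near zero. The factor \<open>B\<close>
    absorbs the finitely many coarser scales, on which \<psi> is taken constant.\<close>
  define B where "B = Max ((\<lambda>j. a j / a J) ` {..J})"
  have B: "a j \<le> B * a J" if "j \<le> J" for j
  proof -
    have "a j / a J \<le> B" unfolding B_def using that by (intro Max_ge) auto
    then show ?thesis using a0[of J] by (simp add: field_simps)
  qed
  have B1: "1 \<le> B" using B[of J] a0[of J] by simp
  define \<psi> where "\<psi> j = B * a (max j J)" for j
  have "0 < \<psi> j" for j using B1 a0 by (simp add: \<psi>_def)
  moreover have "\<psi> j \<le> \<psi> i" if "i \<le> j" for i j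
    using B1 that unfolding \<psi>_def by (intro mult_left_mono a_mono) auto
  moreover have "\<psi> \<longlonglongrightarrow> 0"
  proof -
    have "(\<lambda>j. B * a j) \<longlonglongrightarrow> 0" using tendsto_mult_left[OF a_lim, of B] by simp
    then show ?thesis
    proof (rule Lim_transform_eventually)
      show "eventually (\<lambda>j. B * a j = \<psi> j) sequentially"
        using eventually_ge_at_top[of J] by eventually_elim (simp add: \<psi>_def max_def)
    qed
  qed
  moreover have "g (1 / 2 ^ j) \<le> \<psi> j * h (1 / 2 ^ j)" for j
  proof -
    have "a j \<le> \<psi> j"
    proof (cases "j \<le> J")
      case True
      then show ?thesis using B[of j] by (simp add: \<psi>_def max_def)
    next
      case False
      then show ?thesis using B1 a0[of j] by (simp add: \<psi>_def max_def)
    qed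
    then show ?thesis using gauge_pos[OF h, of "1 / 2 ^ j"] by (simp add: a_def field_simps)
  qed
  moreover have "\<psi> j \<le> B * K * \<phi> (1 / 2 ^ j)" for j
  proof -
    have "a (max j J) \<le> K * f (max j J)" by (rule aK) simp
    also have "\<dots> \<le> K * f j"
    proof (rule mult_left_mono[OF f_mono])
      have "0 < K * f J" using aK[of J] a0[of J] by simp
      then show "0 \<le> K" using f0[of J] by (simp add: zero_less_mult_iff)
    qed simp
    finally show ?thesis using B1 by (simp add: \<psi>_def f_def mult_left_mono mult.assoc)
  qed
  ultimately show ?thesis by blast
qed

lemma dyadic_level_exists:
  assumes "0 < q"
  shows "\<exists>l. real q \<le> 2 ^ l \<and> 2 ^ l \<le> 2 * real q"
proof -
  define l where "l = (LEAST l. real q \<le> 2 ^ l)"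
  obtain n where "real q < 2 ^ n" using real_arch_pow[of 2 "real q"] by auto
  then have "real q \<le> 2 ^ n" by simp
  then have l: "real q \<le> 2 ^ l" unfolding l_def by (rule LeastI)
  have "2 ^ l \<le> 2 * real q"
  proof (cases l)
    case 0
    then show ?thesis using assms by simp
  next
    case (Suc k)
    then have "\<not> real q \<le> 2 ^ k" unfolding l_def by (intro not_less_Least) simp
    then show ?thesis using Suc by simp
  qed
  then show ?thesis using l by blast
qed

lemma qn_bounds:
  assumes "0 < r n" "r n \<le> 1"
  shows "0 < qn r n" "1 / real (qn r n) \<le> r n" "r n \<le> 2 / real (qn r n)"
proof -
  have ceil: "1 / r n \<le> of_int \<lceil>1 / r n\<rceil>" "of_int \<lceil>1 / r n\<rceil> < 1 / r n + 1" by linarith+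
  have ge1: "1 \<le> 1 / r n" using assms by simp
  then have q: "real (qn r n) = of_int \<lceil>1 / r n\<rceil>" unfolding qn_def using ceil by (intro of_nat_nat) linarith
  show pos: "0 < qn r n" using q ceil ge1 by linarith
  show "1 / real (qn r n) \<le> r n" using ceil(1) pos assms(1) unfolding q[symmetric] by (simp add: field_simps)
  have "real (qn r n) \<le> 2 / r n" using ceil(2) ge1 q by simp
  then show "r n \<le> 2 / real (qn r n)" using pos assms(1) by (simp add: field_simps)
qed

lemma mem_Ikn_iff:
  assumes "0 < qn r n" "0 \<le> x"
  shows "x \<in> Ikn r n k \<longleftrightarrow> nat \<lfloor>real (qn r n) * x\<rfloor> = k"
proof -
  have "x \<in> Ikn r n k \<longleftrightarrow> real k \<le> real (qn r n) * x \<and> real (qn r n) * x < real k + 1"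
    using assms(1) by (auto simp: Ikn_def field_simps)
  also have "\<dots> \<longleftrightarrow> \<lfloor>real (qn r n) * x\<rfloor> = int k" by (auto simp: floor_eq_iff)
  also have "\<dots> \<longleftrightarrow> nat \<lfloor>real (qn r n) * x\<rfloor> = k" using assms by (auto simp: nat_eq_iff)
  finally show ?thesis .
qed

section \<open>Comparison with independent indices\<close>

locale uniform_torus_sequence = prob_space M for M :: "'a measure" +
  fixes X :: "nat \<Rightarrow> 'a \<Rightarrow> real" and r :: "nat \<Rightarrow> real"
  assumes X_measurable: "n \<ge> 1 \<Longrightarrow> X n \<in> borel_measurable M"
    and X_torus: "n \<ge> 1 \<Longrightarrow> w \<in> space M \<Longrightarrow> X n w \<in> torus"
    and X_uniform: "n \<ge> 1 \<Longrightarrow> distr M lborel (X n) = uniform_measure lborel torus"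
    and r_bounds: "n \<ge> 1 \<Longrightarrow> 0 < r n \<and> r n \<le> 1"
begin

lemma prob_X:
  assumes "n \<ge> 1" "A \<in> sets borel"
  shows "prob {w \<in> space M. X n w \<in> A} = measure lborel (torus \<inter> A)"
proof -
  have "prob {w \<in> space M. X n w \<in> A} = measure (distr M lborel (X n)) A"
    using X_measurable[OF assms(1)] assms(2)
    by (subst measure_distr) (auto simp: vimage_def Int_def conj_commute)
  also have "\<dots> = measure lborel (torus \<inter> A)"
    using assms(2) unfolding X_uniform[OF assms(1)]
    by (subst measure_uniform_measure) (auto simp: torus_def)
  finally show ?thesis .
qed

lemma prob_Ikn:
  assumes n: "n \<ge> 1" and k: "k < qn r n"
  shows "prob {w \<in> space M. X n w \<in> Ikn r n k} = 1 / real (qn r n)"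
proof -
  have q: "0 < real (qn r n)" using k by simp
  have "real (k + 1) \<le> real (qn r n)" using k by (subst of_nat_le_iff) simp
  then have "Ikn r n k \<subseteq> torus" using q
    by (auto simp: Ikn_def torus_def pos_less_divide_eq intro: order_trans[rotated])
  then have "prob {w \<in> space M. X n w \<in> Ikn r n k} = measure lborel (Ikn r n k)"
    by (subst prob_X[OF n]) (auto simp: Ikn_def Int_absorb1)
  also have "\<dots> = 1 / real (qn r n)" using q by (simp add: Ikn_def diff_divide_distrib[symmetric] divide_right_mono)
  finally show ?thesis .
qed

text \<open>Indices are shifted: \<open>idx w n\<close> is the cell of \<open>X (Suc n) w\<close>.\<close>

definition idx :: "'a \<Rightarrow> nat \<Rightarrow> nat" where
  "idx w n = nat \<lfloor>real (qn r (Suc n)) * X (Suc n) w\<rfloor>"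

sublocale finite_cells "\<lambda>n. qn r (Suc n)"
  using qn_bounds(1) r_bounds by unfold_locales auto

lemma idx_less: "w \<in> space M \<Longrightarrow> idx w n < qn r (Suc n)"
  using X_torus[of "Suc n" w] q_pos[of n]
  by (auto simp: idx_def torus_def nat_less_iff floor_less_iff)

lemma X_in_Ikn_iff: "w \<in> space M \<Longrightarrow> X (Suc n) w \<in> Ikn r (Suc n) k \<longleftrightarrow> idx w n = k"
  using X_torus[of "Suc n" w] q_pos[of n] unfolding idx_def
  by (intro mem_Ikn_iff) (auto simp: torus_def)

lemma idx_cylinder_sets: "{w \<in> space M. \<forall>n<N. idx w n = \<kappa> n} \<in> events"
proof -
  have "{w \<in> space M. \<forall>n<N. idx w n = \<kappa> n} = {w \<in> space M. \<forall>n<N. X (Suc n) w \<in> Ikn r (Suc n) (\<kappa> n)}"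
    using X_in_Ikn_iff by auto
  also have "\<dots> \<in> events"
  proof (rule sets.sets_Collect_countable_All)
    fix n
    have "X (Suc n) -` Ikn r (Suc n) (\<kappa> n) \<inter> space M \<in> events"
      by (rule measurable_sets[OF X_measurable]) (auto simp: Ikn_def)
    then show "{w \<in> space M. n < N \<longrightarrow> X (Suc n) w \<in> Ikn r (Suc n) (\<kappa> n)} \<in> events"
      by (cases "n < N") (auto simp: vimage_def Int_def conj_commute)
  qed
  finally show ?thesis .
qed

lemma prob_cylinder_le:
  assumes "Theta M X (Bcoll r) \<le> ereal C" "1 \<le> C" and \<kappa>: "\<kappa> \<in> PiE {..<N} (\<lambda>n. {..<qn r (Suc n)})"
  shows "prob {w \<in> space M. \<forall>n<N. idx w n = \<kappa> n} \<le> C / (\<Prod>n<N. real (qn r (Suc n)))"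
proof (cases "N = 0")
  case True
  then show ?thesis using assms(2) prob_space by simp
next
  case False
  \<comment> \<open>Members of \<open>Bcoll\<close> are infinite sequences starting at 1: \<kappa>
    is shifted by one and continued by cell 0.\<close>
  define k where "k i = (if i \<in> {1..N} then \<kappa> (i - 1) else 0)" for i
  define B where "B i = Ikn r i (k i)" for i
  have k: "k i < qn r i" if "1 \<le> i" for i
  proof (cases "i \<in> {1..N}")
    case True
    then have "\<kappa> (i - 1) \<in> {..<qn r (Suc (i - 1))}" by (intro PiE_mem[OF \<kappa>]) auto
    then show ?thesis using True by (simp add: k_def)
  next
    case False
    then show ?thesis using qn_bounds(1)[of r i] r_bounds[OF that] by (auto simp: k_def)
  qed
  then have "B \<in> Bcoll r" by (auto simp: Bcoll_def B_def)
  then have le1: "theta M X B \<le> Theta M X (Bcoll r)" unfolding Theta_def by (rule SUP_upper)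
  have le2: "ereal (prob {w \<in> space M. \<forall>i\<in>{1..N}. X i w \<in> B i}
        / (\<Prod>i=1..N. prob {w \<in> space M. X i w \<in> B i})) \<le> theta M X B"
    unfolding theta_def using False by (intro SUP_upper) auto
  from order_trans[OF le2 order_trans[OF le1 assms(1)]]
  have "prob {w \<in> space M. \<forall>i\<in>{1..N}. X i w \<in> B i}
        / (\<Prod>i=1..N. prob {w \<in> space M. X i w \<in> B i}) \<le> C"
    by (simp only: ereal_less_eq)
  moreover have "(\<Prod>i=1..N. prob {w \<in> space M. X i w \<in> B i}) = 1 / (\<Prod>n<N. real (qn r (Suc n)))"
  proof -
    have "(\<Prod>i=1..N. prob {w \<in> space M. X i w \<in> B i}) = (\<Prod>i=1..N. 1 / real (qn r i))"
      unfolding B_def by (intro prod.cong refl prob_Ikn k) auto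
    also have "\<dots> = (\<Prod>n<N. 1 / real (qn r (Suc n)))"
      by (rule prod.reindex_bij_witness[of _ Suc "\<lambda>i. i - 1"]) auto
    finally show ?thesis by (simp add: prod_dividef)
  qed
  moreover have "{w \<in> space M. \<forall>i\<in>{1..N}. X i w \<in> B i} = {w \<in> space M. \<forall>n<N. idx w n = \<kappa> n}"
  proof -
    have "{1..N} = Suc ` {..<N}" by (simp add: image_Suc_lessThan)
    then have "(\<forall>i\<in>{1..N}. X i w \<in> B i) \<longleftrightarrow> (\<forall>n<N. X (Suc n) w \<in> Ikn r (Suc n) (\<kappa> n))" for w
      by (auto simp: B_def k_def)
    then show ?thesis using X_in_Ikn_iff by auto
  qed
  moreover have "0 < (\<Prod>n<N. real (qn r (Suc n)))" using q_pos by (intro prod_pos) auto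
  ultimately show ?thesis by (simp add: field_simps)
qed

text \<open>An event decided by finitely many indices is a finite union of cylinders, each of
  probability at most \<open>C\<close> times its uniform weight. This is how the bound on
  \<open>Theta\<close> replaces independence.\<close>

lemma prob_idx_le:
  assumes T: "Theta M X (Bcoll r) \<le> ereal C" "1 \<le> C"
    and Q: "\<And>u u'. (\<And>n. n < N \<Longrightarrow> u n = u' n) \<Longrightarrow> Q u = Q u'"
  shows "{w \<in> space M. Q (idx w)} \<in> events"
    and "prob {w \<in> space M. Q (idx w)} \<le> C * Avg 0 N (\<lambda>u. of_bool (Q u)) u0"
proof -
  let ?Pi = "PiE {..<N} (\<lambda>n. {..<qn r (Suc n)})"
  let ?cyl = "\<lambda>\<kappa>. {w \<in> space M. \<forall>n<N. idx w n = \<kappa> n}"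
  have fin: "finite ?Pi" by (intro finite_PiE) auto
  have eq: "{w \<in> space M. Q (idx w)} = (\<Union>\<kappa>\<in>{\<kappa> \<in> ?Pi. Q \<kappa>}. ?cyl \<kappa>)"
  proof (intro set_eqI iffI)
    fix w assume "w \<in> {w \<in> space M. Q (idx w)}"
    then have w: "w \<in> space M" "Q (idx w)" by auto
    let ?\<kappa> = "restrict (idx w) {..<N}"
    have "Q ?\<kappa> = Q (idx w)" by (rule Q) simp
    moreover have "?\<kappa> \<in> ?Pi" using idx_less[OF w(1)] by auto
    ultimately show "w \<in> (\<Union>\<kappa>\<in>{\<kappa> \<in> ?Pi. Q \<kappa>}. ?cyl \<kappa>)" using w by (intro UN_I[of ?\<kappa>]) auto
  next
    fix w assume "w \<in> (\<Union>\<kappa>\<in>{\<kappa> \<in> ?Pi. Q \<kappa>}. ?cyl \<kappa>)"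
    then obtain \<kappa> where "Q \<kappa>" "w \<in> space M" "\<forall>n<N. idx w n = \<kappa> n" by auto
    then show "w \<in> {w \<in> space M. Q (idx w)}" using Q[of "idx w" \<kappa>] by auto
  qed
  have fin': "finite {\<kappa> \<in> ?Pi. Q \<kappa>}" using fin by simp
  show "{w \<in> space M. Q (idx w)} \<in> events"
    unfolding eq by (rule sets.finite_UN[OF fin']) (rule idx_cylinder_sets)
  have "prob {w \<in> space M. Q (idx w)} \<le> (\<Sum>\<kappa>\<in>{\<kappa> \<in> ?Pi. Q \<kappa>}. prob (?cyl \<kappa>))"
    unfolding eq
    by (rule finite_measure_subadditive_finite[OF fin']) (blast intro: idx_cylinder_sets)
  also have "\<dots> \<le> (\<Sum>\<kappa>\<in>{\<kappa> \<in> ?Pi. Q \<kappa>}. C / (\<Prod>n<N. real (qn r (Suc n))))"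
    by (intro sum_mono prob_cylinder_le T) auto
  also have "\<dots> = C * ((\<Sum>\<kappa>\<in>?Pi. of_bool (Q \<kappa>)) / (\<Prod>n<N. real (qn r (Suc n))))"
    using fin by (simp add: of_bool_def sum.If_cases Int_def)
  also have "(\<Sum>\<kappa>\<in>?Pi. of_bool (Q \<kappa>)) / (\<Prod>n<N. real (qn r (Suc n))) = Avg 0 N (\<lambda>u. of_bool (Q u)) u0"
    by (rule Avg_eq_sum_PiE[symmetric]) (rule arg_cong[OF Q])
  finally show "prob {w \<in> space M. Q (idx w)} \<le> C * Avg 0 N (\<lambda>u. of_bool (Q u)) u0" .
qed

text \<open>A point of a closed cell is at distance exactly 1 / q from \<open>X\<close> in that
  half-open cell only if \<open>X\<close> is its left endpoint; excluding this gives the strict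
  inequality in \<open>Eset\<close>.\<close>

lemma AE_not_grid: "AE w in M. \<forall>n c. X (Suc n) w \<noteq> real c / real (qn r (Suc n))"
proof (intro AE_all_countable[THEN iffD2] allI)
  fix n c
  let ?a = "real c / real (qn r (Suc n))"
  have "prob {w \<in> space M. X (Suc n) w \<in> {?a}} = measure lborel (torus \<inter> {?a})"
    by (rule prob_X) auto
  also have "\<dots> \<le> measure lborel {?a}" by (intro measure_mono_fmeasurable) (auto simp: torus_def fmeasurable_def)
  finally have "prob {w \<in> space M. X (Suc n) w = ?a} = 0" by (simp add: measure_le_0_iff)
  moreover have "{w \<in> space M. X (Suc n) w = ?a} \<in> events"
    using measurable_sets[OF X_measurable, of "Suc n" "{?a}"] by (simp add: vimage_def Int_def conj_commute)
  ultimately have "{w \<in> space M. X (Suc n) w = ?a} \<in> null_sets M"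
    by (simp add: null_sets_def emeasure_eq_measure)
  then show "AE w in M. X (Suc n) w \<noteq> ?a" by (rule AE_I'[of "{w \<in> space M. X (Suc n) w = ?a}"]) auto
qed

end

section \<open>From finite stages to the almost sure statement\<close>

context uniform_torus_sequence begin

lemma hausdorff_measure_pos_of_no_cheap_cover:
  assumes W: "weighted_blocks (\<lambda>n. qn r (Suc n)) level (\<lambda>j. h (1 / 2 ^ j)) \<psi> \<phi> K"
    and h: "gauge_fun h" and G: "G \<subseteq> torus" "compactin ttop G"
    and c: "0 < c" and N: "\<And>s. N s \<le> N (Suc s)" and w: "w \<in> space M"
    and grid: "\<forall>n c. X (Suc n) w \<noteq> real c / real (qn r (Suc n))"
    and exp: "\<And>s. \<not> weighted_blocks.cheap_cover (\<lambda>n. qn r (Suc n)) (\<lambda>j. h (1 / 2 ^ j)) G N s s c (idx w)"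
  shows "hausdorff_measure h (Eset (\<lambda>n. X n w) r \<inter> G) > 0"
proof -
  interpret W: weighted_blocks "\<lambda>n. qn r (Suc n)" level "\<lambda>j. h (1 / 2 ^ j)" \<psi> \<phi> K by (rule W)
  define q where "q n = real (qn r (Suc n))" for n
  have q0: "0 < q n" for n using q_pos[of n] by (simp add: q_def)
  \<comment> \<open>Cells are closed here so that the stages \<open>F s\<close> are compact;
    enlarging the stages keeps their covers expensive.\<close>
  define I where "I n = {real (idx w n) / q n .. (real (idx w n) + 1) / q n}" for n
  define F where "F s = {\<xi> \<in> {0..1}. frac \<xi> \<in> G} \<inter> (\<Inter>i<s. \<Union>n\<in>{N i..<N (Suc i)}. I n)" for s
  show ?thesis
  proof (rule hausdorff_measure_pos[OF h])
    show "compact (F s)" for s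
      unfolding F_def I_def using compact_lift[OF G(2)] by (intro compact_Int_closed closed_INT closed_UN) auto
    show "F s' \<subseteq> F s" if "s \<le> s'" for s s' using that by (auto simp: F_def)
    show "F 0 \<subseteq> {0..1}" by (auto simp: F_def)
    show "0 < c" by (rule c)
  next
    fix \<xi> assume \<xi>: "\<And>s. \<xi> \<in> F s"
    have hit: "\<exists>n\<in>{N i..<N (Suc i)}. \<xi> \<in> I n" for i using \<xi>[of "Suc i"] by (auto simp: F_def)
    \<comment> \<open>A block that is hit is nonempty, so hits in all blocks come from infinitely
      many indices.\<close>
    then have "N i < N (Suc i)" for i by (meson atLeastLessThan_iff le_less_trans)
    then have "strict_mono N" by (simp add: strict_mono_Suc_iff)
    then have N_ge: "i \<le> N i" for i by (rule strict_mono_imp_increasing)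
    have near: "tdist (frac \<xi>) (X (Suc n) w) < r (Suc n)" if "\<xi> \<in> I n" for n
    proof -
      have "X (Suc n) w \<in> Ikn r (Suc n) (idx w n)" using X_in_Ikn_iff[OF w] by simp
      moreover have "X (Suc n) w \<noteq> real (idx w n) / q n" using grid by (simp add: q_def)
      ultimately have "real (idx w n) / q n < X (Suc n) w" "X (Suc n) w < (real (idx w n) + 1) / q n"
        by (auto simp: Ikn_def q_def add.commute)
      then have "\<bar>\<xi> - X (Suc n) w\<bar> < (real (idx w n) + 1) / q n - real (idx w n) / q n"
        using that unfolding I_def atLeastAtMost_iff by linarith
      also have "\<dots> = 1 / q n" by (simp add: diff_divide_distrib[symmetric])
      also have "\<dots> \<le> r (Suc n)" unfolding q_def using r_bounds by (intro qn_bounds(2)) auto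
      finally show ?thesis using tdist_le[of \<xi> "X (Suc n) w"] by (simp add: tdist_frac)
    qed
    have "\<exists>\<^sub>\<infinity>n. 1 \<le> n \<and> tdist (frac \<xi>) (X n w) < r n"
      unfolding INFM_nat_le
    proof
      fix m
      obtain n where "n \<in> {N m..<N (Suc m)}" "\<xi> \<in> I n" using hit by blast
      then show "\<exists>n\<ge>m. 1 \<le> n \<and> tdist (frac \<xi>) (X n w) < r n"
        using near N_ge[of m] by (intro exI[of _ "Suc n"]) auto
    qed
    moreover have "frac \<xi> \<in> G" using \<xi>[of 0] by (auto simp: F_def)
    ultimately show "frac \<xi> \<in> Eset (\<lambda>n. X n w) r \<inter> G" using G(1) by (auto simp: Eset_def)
  next
    fix s C
    assume C: "finite (C :: (nat \<times> int) set)"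
      and cov: "\<And>x. x \<in> F s \<Longrightarrow> x < 1 \<Longrightarrow> \<exists>(j, d)\<in>C. dyad j x = d"
    \<comment> \<open>The hypothesis ties the depth to the number of blocks, so both are raised to a
      common \<open>t\<close> that dominates \<open>s\<close> and the scales in
      \<open>C\<close>.\<close>
    define t where "t = Max (insert s (fst ` C))"
    have t: "s \<le> t" "\<forall>(j, d)\<in>C. j \<le> t" using C by (auto simp: t_def intro!: Max_ge rev_image_eqI)
    have covered: "\<exists>(j, d)\<in>C. dyad j x = d"
      if x: "x \<in> G" and hits: "\<forall>i<t. \<exists>n\<in>{N i..<N (Suc i)}. idx w n = W.cell n x" for x
    proof (rule cov)
      have x01: "0 \<le> x" "x < 1" using x G(1) by (auto simp: torus_def)
      then show "x < 1" by simp
      have inI: "x \<in> I n" if "idx w n = W.cell n x" for n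
      proof -
        have "x \<in> Ikn r (Suc n) (idx w n)"
          using x01 q_pos[of n] by (subst mem_Ikn_iff) (auto simp: that W.cell_def)
        then show ?thesis by (auto simp: I_def Ikn_def q_def add.commute)
      qed
      have "\<exists>n\<in>{N i..<N (Suc i)}. x \<in> I n" if "i < s" for i
      proof -
        have "i < t" using that t(1) by simp
        then obtain n where "n \<in> {N i..<N (Suc i)}" "idx w n = W.cell n x" using hits by blast
        then show ?thesis using inI by blast
      qed
      moreover have "frac x = x" using x01 by (simp add: frac_eq)
      ultimately show "x \<in> F s" using x x01 by (simp add: F_def)
    qed
    show "c \<le> (\<Sum>(j, d)\<in>C. h (1 / 2 ^ j))"
    proof (rule ccontr)
      assume "\<not> c \<le> (\<Sum>(j, d)\<in>C. h (1 / 2 ^ j))"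
      then have "(\<Sum>(j, d)\<in>C. h (1 / 2 ^ j)) < c" by simp
      then have "W.cheap_cover G N t t c (idx w)"
        unfolding W.cheap_cover_def by (intro exI[of _ C] conjI C t(2) ballI impI covered)
      then show False using exp by simp
    qed
  qed
qed

lemma hausdorff_measure_pos_outside_small_event:
  assumes W: "weighted_blocks (\<lambda>n. qn r (Suc n)) level (\<lambda>j. h (1 / 2 ^ j)) \<psi> \<phi> K"
    and h: "gauge_fun h" and g: "gauge_fun g" and g_le: "\<And>j. g (1 / 2 ^ j) \<le> \<psi> j * h (1 / 2 ^ j)"
    and G: "G \<subseteq> torus" "compactin ttop G" and pos: "hausdorff_measure g G > 0"
    and T: "Theta M X (Bcoll r) < \<infinity>" and \<delta>: "0 < \<delta>"
  shows "\<exists>A\<in>events. prob A \<le> \<delta> \<and>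
    (AE w in M. w \<notin> A \<longrightarrow> hausdorff_measure h (Eset (\<lambda>n. X n w) r \<inter> G) > 0)"
proof -
  interpret W: weighted_blocks "\<lambda>n. qn r (Suc n)" level "\<lambda>j. h (1 / 2 ^ j)" \<psi> \<phi> K by (rule W)
  obtain T0 where "Theta M X (Bcoll r) \<le> ereal T0"
    using T by (cases "Theta M X (Bcoll r)") auto
  \<comment> \<open>The bound is raised to at least 1 so that it also covers the empty cylinder and
    may be divided by.\<close>
  then have "Theta M X (Bcoll r) \<le> ereal (max 1 T0)"
    by (rule order_trans) simp
  then obtain C where C: "Theta M X (Bcoll r) \<le> ereal C" "1 \<le> C" by (meson max.cobounded1)
  obtain c0 where c0: "0 < c0" and
    content: "\<And>C. finite C \<Longrightarrow> \<forall>x\<in>G. \<exists>(j, d)\<in>C. dyad j x = d \<Longrightarrow> c0 \<le> (\<Sum>(j, d)\<in>C. g (1 / 2 ^ j))"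
    using dyadic_content_pos[OF g G(1) pos] by meson
  have frostman: "\<exists>P m. finite P \<and> P \<subseteq> G \<and> W.mass_bounded P L m 1 \<and> c0 \<le> (\<Sum>x\<in>P. m x)" for L
  proof -
    obtain P m D where "flow_cut (\<lambda>j. g (1 / 2 ^ j)) G L 0 0 P m D"
      using flow_cut_exists[of "\<lambda>j. g (1 / 2 ^ j)" 0 L G 0] gauge_nonneg[OF g] by auto
    then have fc: "finite P" "P \<subseteq> {x \<in> G. dyad 0 x = 0}" "\<forall>x\<in>P. 0 \<le> m x"
      "\<forall>j d. 0 \<le> j \<longrightarrow> j \<le> L \<longrightarrow> mass P m j d \<le> g (1 / 2 ^ j)" "finite D"
      "\<forall>x\<in>G. dyad 0 x = 0 \<longrightarrow> (\<exists>(j, e)\<in>D. dyad j x = e)"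
      "(\<Sum>(j, e)\<in>D. g (1 / 2 ^ j)) \<le> (\<Sum>x\<in>P. m x)"
      unfolding flow_cut_def by - (elim conjE, assumption)+
    have "\<forall>x\<in>G. \<exists>(j, e)\<in>D. dyad j x = e"
      using fc(6) dyad_0 G(1) by (auto simp: torus_def subset_iff)
    then have "c0 \<le> (\<Sum>x\<in>P. m x)" using content[OF fc(5)] fc(7) by simp
    moreover have "W.mass_bounded P L m 1"
      unfolding W.mass_bounded_def using fc(3,4) order_trans[OF _ g_le] by simp
    ultimately show ?thesis using fc(1,2) by blast
  qed
  have G01: "G \<subseteq> {0..<1}" and \<delta>C: "0 < \<delta> / C" using G(1) \<delta> C(2) by (auto simp: torus_def)
  obtain N c where c: "0 < c" and N: "N 0 = 0" "\<And>s. N s \<le> N (Suc s)" and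
    small: "\<And>s L u. Avg 0 (N s) (\<lambda>u. of_bool (W.cheap_cover G N s L c u)) u \<le> \<delta> / C"
    using W.blocks_without_cheap_cover[OF G01 c0 \<delta>C frostman] by meson
  have N_mono: "N s \<le> N s'" if "s \<le> s'" for s s' using N(2) that by (rule lift_Suc_mono_le)
  have agree: "W.cheap_cover G N s s c u = W.cheap_cover G N s s c u'"
    if "\<And>n. n < N s \<Longrightarrow> u n = u' n" for s u u'
  proof -
    have "(\<forall>i<s. \<exists>n\<in>{N i..<N (Suc i)}. u n = W.cell n x) \<longleftrightarrow>
        (\<forall>i<s. \<exists>n\<in>{N i..<N (Suc i)}. u' n = W.cell n x)" for x
    proof (intro all_cong bex_cong refl)
      fix i n assume "i < s" "n \<in> {N i..<N (Suc i)}"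
      then have "n < N s" using N_mono[of "Suc i" s] by simp
      then show "(u n = W.cell n x) = (u' n = W.cell n x)" using that by simp
    qed
    then show ?thesis unfolding W.cheap_cover_def by simp
  qed
  define Bad where "Bad s = {w \<in> space M. W.cheap_cover G N s s c (idx w)}" for s
  have Bad: "Bad s \<in> events" "prob (Bad s) \<le> \<delta>" for s
  proof -
    show "Bad s \<in> events" unfolding Bad_def by (rule prob_idx_le(1)[OF C agree])
    have "prob (Bad s) \<le> C * Avg 0 (N s) (\<lambda>u. of_bool (W.cheap_cover G N s s c u)) (\<lambda>_. 0)"
      unfolding Bad_def by (rule prob_idx_le(2)[OF C agree])
    also have "\<dots> \<le> C * (\<delta> / C)" using C(2) by (intro mult_left_mono small) auto
    finally show "prob (Bad s) \<le> \<delta>" using C(2) by simp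
  qed
  \<comment> \<open>On the diagonal, with depth equal to the number of blocks, the bad events
    increase, so their union inherits the bound \<delta>.\<close>
  have "incseq Bad"
    unfolding Bad_def by (intro monoI Collect_mono) (auto intro: W.cheap_cover_mono)
  then have "(\<lambda>s. prob (Bad s)) \<longlonglongrightarrow> prob (\<Union>s. Bad s)"
    using Bad(1) by (intro finite_Lim_measure_incseq) auto
  then have "prob (\<Union>s. Bad s) \<le> \<delta>"
    by (rule LIMSEQ_le_const2) (use Bad(2) in auto)
  moreover have "(\<Union>s. Bad s) \<in> events" using Bad(1) by auto
  moreover have "AE w in M. w \<notin> (\<Union>s. Bad s) \<longrightarrow> hausdorff_measure h (Eset (\<lambda>n. X n w) r \<inter> G) > 0"
    using AE_not_grid AE_space
  proof eventually_elim
    case (elim w)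
    show ?case
    proof
      assume "w \<notin> (\<Union>s. Bad s)"
      then have "\<not> W.cheap_cover G N s s c (idx w)" for s using elim(2) by (auto simp: Bad_def)
      then show "hausdorff_measure h (Eset (\<lambda>n. X n w) r \<inter> G) > 0"
        by (intro hausdorff_measure_pos_of_no_cheap_cover[where N = N, OF W h G c] N(2) elim(2,1))
    qed
  qed
  ultimately show ?thesis by blast
qed

lemma AE_of_small_exceptional_events:
  assumes "\<And>\<delta>. 0 < \<delta> \<Longrightarrow> \<exists>A\<in>events. prob A \<le> \<delta> \<and> (AE w in M. w \<notin> A \<longrightarrow> Q w)"
  shows "AE w in M. Q w"
proof -
  have "\<forall>k. \<exists>A. A \<in> events \<and> prob A \<le> 1 / real (Suc k) \<and> (AE w in M. w \<notin> A \<longrightarrow> Q w)"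
    using assms by (meson divide_pos_pos of_nat_0_less_iff zero_less_Suc zero_less_one)
  then obtain A where A: "\<And>k. A k \<in> events" "\<And>k. prob (A k) \<le> 1 / real (Suc k)"
    "\<And>k. AE w in M. w \<notin> A k \<longrightarrow> Q w" by metis
  have Z: "(\<Inter>k. A k) \<in> events" using A(1) by auto
  have "prob (\<Inter>k. A k) \<le> 1 / real (Suc k)" for k
    using finite_measure_mono[of "\<Inter>k. A k" "A k"] A(1,2)[of k] by (meson INT_lower UNIV_I order_trans)
  then have "prob (\<Inter>k. A k) \<le> 0"
    by (intro LIMSEQ_le_const[OF LIMSEQ_inverse_real_of_nat]) (auto simp: inverse_eq_divide)
  then have "(\<Inter>k. A k) \<in> null_sets M"
    using Z by (simp add: null_sets_def emeasure_eq_measure measure_le_0_iff)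
  then have "AE w in M. w \<notin> (\<Inter>k. A k)" by (rule AE_not_in)
  moreover have "AE w in M. \<forall>k. w \<notin> A k \<longrightarrow> Q w" 
    by (intro AE_all_countable[THEN iffD2] allI A(3))
  ultimately show ?thesis by eventually_elim auto
qed

end

theorem theorem3p3:
  fixes M :: "'a measure" and X :: "nat \<Rightarrow> 'a \<Rightarrow> real" and r :: "nat \<Rightarrow> real"
    and G :: "real set" and g h \<phi> :: "real \<Rightarrow> real"
  assumes "prob_space M"
    and "\<And>n. n \<ge> 1 \<Longrightarrow> X n \<in> borel_measurable M"
    and "\<And>n \<omega>. n \<ge> 1 \<Longrightarrow> \<omega> \<in> space M \<Longrightarrow> X n \<omega> \<in> torus"
    and "\<And>n. n \<ge> 1 \<Longrightarrow> distr M lborel (X n) = uniform_measure lborel torus"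
    and "\<And>n. n \<ge> 1 \<Longrightarrow> 0 < r n \<and> r n \<le> 1"
    and "G \<subseteq> torus" and "G \<noteq> {}" and "compactin ttop G"
    and "gauge_fun g" and "hausdorff_measure g G > 0"
    and "gauge_fun h" and "gauge_fun \<phi>" and "gauge_prec h \<phi> g"
    and "Theta M X (Bcoll r) < \<infinity>"
    and "\<not> summable (\<lambda>n. r (Suc n) / \<phi> (r (Suc n)))"
  shows "AE \<omega> in M. hausdorff_measure h (Eset (\<lambda>n. X n \<omega>) r \<inter> G) > 0"
proof -
  interpret uniform_torus_sequence M X r
    using assms(1-5) by (intro uniform_torus_sequence.intro uniform_torus_sequence_axioms.intro) auto
  obtain \<psi> K where \<psi>: "\<And>j. 0 < \<psi> j" "\<And>i j. i \<le> j \<Longrightarrow> \<psi> j \<le> \<psi> i" "\<psi> \<longlonglongrightarrow> 0"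
    "\<And>j. g (1 / 2 ^ j) \<le> \<psi> j * h (1 / 2 ^ j)" "\<And>j. \<psi> j \<le> K * \<phi> (1 / 2 ^ j)"
    using gauge_prec_ratio[OF assms(9,11,12,13)] by meson
  have q: "0 < qn r (Suc n)" "1 / real (qn r (Suc n)) \<le> r (Suc n)" "r (Suc n) \<le> 2 / real (qn r (Suc n))" for n
    using qn_bounds[of r "Suc n"] r_bounds[of "Suc n"] by auto
  obtain level where level: "\<And>n. real (qn r (Suc n)) \<le> 2 ^ level n" "\<And>n. 2 ^ level n \<le> 2 * real (qn r (Suc n))"
    using dyadic_level_exists[OF q(1)] by metis
  have "weighted_blocks (\<lambda>n. qn r (Suc n)) level (\<lambda>j. h (1 / 2 ^ j)) \<psi> (\<lambda>j. \<phi> (1 / 2 ^ j)) K"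
  proof
    show "h (1 / 2 ^ j) \<le> h (1 / 2 ^ i)" if "i \<le> j" for i j :: nat
      using that by (intro gauge_mono[OF assms(11)] divide_left_mono power_increasing) auto
    \<comment> \<open>Since 2^-(level n) \<le> 1 / q \<le> r \<le> 2 / q and \<phi> is
      nondecreasing, r / \<phi>(r) is at most twice the weight of the index, so divergence carries
      over.\<close>
    show "\<not> summable (\<lambda>n. 1 / (real (qn r (Suc n)) * \<phi> (1 / 2 ^ level n)))"
    proof
      assume "summable (\<lambda>n. 1 / (real (qn r (Suc n)) * \<phi> (1 / 2 ^ level n)))"
      then have "summable (\<lambda>n. 2 * (1 / (real (qn r (Suc n)) * \<phi> (1 / 2 ^ level n))))" by (rule summable_mult)
      then have "summable (\<lambda>n. r (Suc n) / \<phi> (r (Suc n)))"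
      proof (rule summable_comparison_test'[where N=0])
        fix n
        have r: "0 < r (Suc n)" using r_bounds[of "Suc n"] by simp
        have "1 / 2 ^ level n \<le> 1 / real (qn r (Suc n))" using level(1)[of n] q(1)[of n] by (intro divide_left_mono) auto
        then have "1 / 2 ^ level n \<le> r (Suc n)" using q(2)[of n] by linarith
        then have \<phi>: "\<phi> (1 / 2 ^ level n) \<le> \<phi> (r (Suc n))" by (intro gauge_mono[OF assms(12)]) auto
        have "r (Suc n) / \<phi> (r (Suc n)) \<le> (2 / real (qn r (Suc n))) / \<phi> (1 / 2 ^ level n)"
          by (intro frac_le \<phi> q(3) gauge_pos[OF assms(12)]) auto
        then show "norm (r (Suc n) / \<phi> (r (Suc n))) \<le> 2 * (1 / (real (qn r (Suc n)) * \<phi> (1 / 2 ^ level n)))"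
          using r gauge_pos[OF assms(12) r] by simp
      qed
      then show False using assms(15) by contradiction
    qed
  qed (use level \<psi> gauge_pos[OF assms(11)] gauge_pos[OF assms(12)] in auto)
  from hausdorff_measure_pos_outside_small_event[OF this assms(11,9) \<psi>(4) assms(6,8,10,14)]
  show ?thesis by (rule AE_of_small_exceptional_events)
qed

end
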